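(* Assume the following. (1) For $\mu$-a.e. $s\in E$, the operator $A(s,\cdot)$ is maximal monotone; and for every $\lambda>0$ and $x\in\mathcal H$, the map $s\mapsto J_\lambda(s,x)$ is $\mathcal E/\mathcal B(\mathcal H)$-measurable. (2) $(\lambda_n)_{n\in\mathbb N}$ is a sequence of positive reals with $\sum_n\lambda_n=+\infty$ and $\sum_n\lambda_n^2<\infty$; the random variables $(\xi_n)_{n\ge1}$ are independent and identically distributed with distribution $\mu$. (3) For every $M>0$ there exists $\kappa_M>0$ such that for all $x\in\mathcal H$ with $\|x\|\le M$, $\int d(x,D_s)^2\,d\mu(s)\ge \kappa_M\, d(x,\mathcal D)^2$. (4) There exist an integer $p\ge1$ and a function $C\in L^2(E,\mathbb R_+,\mu)$ such that for all $x\in\mathcal H$ and $\lambda>0$, $\|J_\lambda(s,x)-\Pi(s,x)\|\le \lambda\, C(s)(1+\|x\|^p)$ for $\mu$-a.e. $s$, and $\mathcal Z_A(2p)\neq\emptyset$. Suppose that $\lambda_n/\lambda_{n+1}\to1$ as $n\to\infty$. Let $x_0\in\mathcal H$ be fixed and let $(x_n)$ be defined by $x_{n+1}=J_{\lambda_n}(\xi_{n+1},x_n)$, $n\in\mathbb N$. Then, almost surely, $$\sup_{n\ge1}\ \frac{\sum_{k=1}^n d(x_k,\mathcal D)}{\sum_{k=1}^n\lambda_k}<\infty .$$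
   Context: $(E,\mathcal E,\mu)$ is a complete probability space, $\mathcal H$ is a separable Hilbert space with Borel $\sigma$-algebra $\mathcal B(\mathcal H)$, $A:E\times\mathcal H\to2^{\mathcal H}$ is a set-valued mapping, $(\Omega,\mathcal F,\mathbb P)$ is a probability space and $\xi_n:\Omega\to E$ ($n\ge1$) are random variables. For $\lambda>0$, $J_\lambda(s,x)=(I+\lambda A(s,\cdot))^{-1}(x)$ is the resolvent (single-valued and defined on all of $\mathcal H$ whenever $A(s,\cdot)$ is maximal monotone). $D_s=\mathrm{dom}(A(s,\cdot))=\{x: A(s,x)\ne\emptyset\}$. The essential intersection $\mathcal D$ of the domains is the set of $x\in\mathcal H$ such that $x\in D_s$ for all $s$ outside some $\mu$-negligible set (depending on $x$). $\Pi(s,x)$ is the projection of $x$ onto the closure $\mathrm{cl}(D_s)$. $d(x,Q)=\inf_{y\in Q}\|x-y\|$, equal to $+\infty$ if $Q=\emptyset$. For $x\in\mathcal H$ and $p\ge1$, $S_A^p(x)$ is the set of measurable functions $\phi:E\to\mathcal H$ with $\phi(s)\in A(s,x)$ for $\mu$-a.e. $s$ and $\int\|\phi\|^p d\mu<\infty$, and $\mathcal Z_A(p)=\{x\in\mathcal H:\exists\phi\in S_A^p(x),\ \int\phi\,d\mu=0\}$ (Bochner integral). *)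

theory Defs
  imports "HOL-Probability.Probability"
begin

definition op_dom :: "('h \<Rightarrow> 'h set) \<Rightarrow> 'h set" where
  "op_dom B = {x. B x \<noteq> {}}"

definition op_graph :: "('h \<Rightarrow> 'h set) \<Rightarrow> ('h \<times> 'h) set" where
  "op_graph B = {(x, u). u \<in> B x}"

definition monotone_op :: "('h::real_inner \<Rightarrow> 'h set) \<Rightarrow> bool" where
  "monotone_op B \<longleftrightarrow>
     (\<forall>(x, u) \<in> op_graph B. \<forall>(y, v) \<in> op_graph B. 0 \<le> inner (x - y) (u - v))"

definition maximal_monotone_op :: "('h::real_inner \<Rightarrow> 'h set) \<Rightarrow> bool" where
  "maximal_monotone_op B \<longleftrightarrow>
     monotone_op B \<and> (\<forall>B'. monotone_op B' \<and> op_graph B \<subseteq> op_graph B' \<longrightarrow> op_graph B' = op_graph B)"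

definition resolvent_set :: "real \<Rightarrow> ('h::real_vector \<Rightarrow> 'h set) \<Rightarrow> 'h \<Rightarrow> 'h set" where
  "resolvent_set l B x = {y. \<exists>u\<in>B y. x = y + l *\<^sub>R u}"

(* Only meaningful where resolvent_set is a singleton, which holds for every x if B is maximal
   monotone and l > 0; elsewhere the value is unspecified. *)
definition resolvent :: "real \<Rightarrow> ('h::real_vector \<Rightarrow> 'h set) \<Rightarrow> 'h \<Rightarrow> 'h" where
  "resolvent l B x = the_elem (resolvent_set l B x)"

(* Unlike infdist, whose value is 0 on the empty set, this is infinite there. *)
definition set_edist :: "'h::real_normed_vector \<Rightarrow> 'h set \<Rightarrow> ennreal" where
  "set_edist x Q = (INF y\<in>Q. ennreal (norm (x - y)))"

(* The library's closest_point is restricted to heine_borel spaces, hence to finite dimension.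
   Meaningful for nonempty closed convex Q, such as the closure of the domain of a maximal
   monotone operator. *)
definition projection :: "'h::real_inner set \<Rightarrow> 'h \<Rightarrow> 'h" where
  "projection Q x = (THE y. y \<in> Q \<and> (\<forall>z\<in>Q. norm (x - y) \<le> norm (x - z)))"

definition essential_domain :: "'e measure \<Rightarrow> ('e \<Rightarrow> 'h \<Rightarrow> 'h set) \<Rightarrow> 'h set" where
  "essential_domain \<mu> A = {x. AE s in \<mu>. x \<in> op_dom (A s)}"

definition selections ::
  "'e measure \<Rightarrow> ('e \<Rightarrow> 'h \<Rightarrow> 'h set) \<Rightarrow> real \<Rightarrow> 'h::{real_inner, banach, second_countable_topology}
    \<Rightarrow> ('e \<Rightarrow> 'h) set" where
  "selections \<mu> A p x =
     {\<phi> \<in> borel_measurable \<mu>. (AE s in \<mu>. \<phi> s \<in> A s x) \<and> integrable \<mu> (\<lambda>s. norm (\<phi> s) powr p)}"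

(* has_bochner_integral rather than the integral operator, which returns 0 on
   non-integrable functions. *)
definition zeros ::
  "'e measure \<Rightarrow> ('e \<Rightarrow> 'h \<Rightarrow> 'h::{real_inner, banach, second_countable_topology} set) \<Rightarrow> real
    \<Rightarrow> 'h set" where
  "zeros \<mu> A p = {x. \<exists>\<phi>\<in>selections \<mu> A p x. has_bochner_integral \<mu> \<phi> 0}"

end

theory Submission
  imports Defs
begin

text \<open>
  Write \<open>D\<close> for the essential domain and \<open>d\<close> for the distance to it. For a small parameter the
  resolvent is close to the projection onto the closure of a randomly chosen \<open>op_dom (A s)\<close>. Such a
  projection decreases the squared distance to every point of \<open>D\<close>, by an amount whose mean the
  separation hypothesis bounds below by a multiple of \<open>d\<^sup>2\<close>. On the set \<open>norm x \<le> R\<close> this gives,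
  conditionally on the past, \<open>E d(x_{n+1})^2 \<le> \<rho> d(x_n)^2 + K \<lambda>_n^2\<close> with \<open>\<rho> < 1\<close>, which is
  \<open>resolvent_infdist_mean_square_le\<close>. By Jensen the conditional mean of
  \<open>d(x_{n+1})\<close> is at most \<open>b_n = sqrt (\<rho> d(x_n)^2 + K \<lambda>_n^2)\<close>, hence at most
  \<open>sqrt \<rho> d(x_n) + sqrt K \<lambda>_n\<close>. If the partial sums of
  \<open>d(x_{n+1}) - b_n\<close> stay bounded above, summation therefore yields
  \<open>(1 - sqrt \<rho>) (\<Sum> d(x_k)) \<le> const + sqrt K (\<Sum> \<lambda>_k)\<close>, which is the claim
  (\<open>sum_le_of_contraction\<close>).

  Almost sure bounds come from one maximal inequality: a nonnegative supermartingale is almost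
  surely bounded (\<open>driven_supermartingale_bounded\<close>). It is used twice.
  The iterates are bounded because their squared distance to a zero \<open>y\<close> of the mean operator
  increases in conditional mean by at most a multiple of \<open>\<lambda>_n^2\<close>
  (\<open>resolvent_mean_square_le\<close>). The partial sums \<open>Y_n\<close> of \<open>d(x_{n+1}) - b_n\<close> are bounded above
  because \<open>(max 0 Y_n)^2 + \<alpha> d(x_n)^2\<close> is, for a suitable \<open>\<alpha>\<close> and up to a summable
  correction, a supermartingale as long as the iterates stay in the ball of radius \<open>R\<close>
  (\<open>driven_contraction_increments_bounded\<close>).

  That the resolvent of a maximal monotone operator is defined everywhere is Minty's theorem. It
  is derived here from Kirszbraun's one-point extension of a nonexpansive map, which in turn
  follows from the completeness of the space by maximising a strongly concave function.
\<close>

section \<open>Kirszbraun extension and Minty's theorem\<close>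

text \<open>
  The set \<open>S\<close> is the graph of a nonexpansive map, and the conclusion says that the map extends to
  the point \<open>0\<close> with value \<open>z\<close>. Lift the points \<open>q\<close> to the heights
  \<open>norm q ^ 2 - norm p ^ 2\<close> and let \<open>K\<close> be the convex hull. Nonexpansiveness makes the function
  \<open>height - norm q ^ 2\<close> nonpositive on \<open>K\<close>. It is strongly concave in \<open>q\<close>, so the \<open>q\<close>-components of a
  maximising sequence form a Cauchy sequence; the first-order optimality condition at their limit
  \<open>y\<close>, in the direction of a lifted point, is \<open>norm (y - q) ^ 2 - norm p ^ 2 \<le> m\<close>, where \<open>m \<le> 0\<close> is
  the supremum.
\<close>
lemma kirszbraun_one_point:
  fixes S :: "('a::real_inner \<times> 'b::{real_inner,banach}) set"
  assumes ne: "S \<noteq> {}"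
    and contr: "\<And>p q p' q'. (p, q) \<in> S \<Longrightarrow> (p', q') \<in> S \<Longrightarrow> norm (q - q') \<le> norm (p - p')"
  shows "\<exists>z. \<forall>(p, q)\<in>S. norm (z - q) \<le> norm p"
proof -
  define T where "T = (\<lambda>(p, q). (p, q, (norm q)\<^sup>2 - (norm p)\<^sup>2)) ` S"
  define K where "K = convex hull T"
  have K_half: "K \<subseteq> {v. inner (fst v) a + inner (fst (snd v)) b + snd (snd v) \<le> r}"
    if "T \<subseteq> {v. inner (fst v) a + inner (fst (snd v)) b + snd (snd v) \<le> r}" for a b r
    unfolding K_def
  proof (rule hull_minimal[OF that])
    have "{v. inner (fst v) a + inner (fst (snd v)) b + snd (snd v) \<le> r} =
          {v. inner (a, b, 1) v \<le> r}"
      by (auto simp: inner_prod_def inner_commute)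
    then show "convex {v. inner (fst v) a + inner (fst (snd v)) b + snd (snd v) \<le> r}"
      using convex_halfspace_le[of "(a, b, 1)" r] by simp
  qed
  \<comment> \<open>A bilinear inequality holds on the hull as soon as it holds on the generators; it is passed
    to the hull in one argument at a time, each time as the inequality of a half-space.\<close>
  have polar: "snd (snd v) + snd (snd v') + 2 * inner (fst v) (fst v')
      - 2 * inner (fst (snd v)) (fst (snd v')) \<le> 0" if "v \<in> K" "v' \<in> K" for v v'
  proof -
    have base: "snd (snd v) + snd (snd v') + 2 * inner (fst v) (fst v')
      - 2 * inner (fst (snd v)) (fst (snd v')) \<le> 0" if vv: "v \<in> T" "v' \<in> T" for v v'
    proof -
      obtain p q p' q' where v: "(p, q) \<in> S" "(p', q') \<in> S"
        "v = (p, q, (norm q)\<^sup>2 - (norm p)\<^sup>2)" "v' = (p', q', (norm q')\<^sup>2 - (norm p')\<^sup>2)"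
        using vv unfolding T_def by auto
      have "(norm (q - q'))\<^sup>2 \<le> (norm (p - p'))\<^sup>2"
        using contr[OF v(1,2)] by (rule power_mono) simp
      then show ?thesis
        unfolding v(3,4)
        by (simp add: power2_norm_eq_inner inner_diff_left inner_diff_right inner_commute)
    qed
    have step: "snd (snd v) + snd (snd v') + 2 * inner (fst v) (fst v')
      - 2 * inner (fst (snd v)) (fst (snd v')) \<le> 0" if vv: "v \<in> K" "v' \<in> T" for v v'
    proof -
      have "T \<subseteq> {v. inner (fst v) (2 *\<^sub>R fst v') + inner (fst (snd v)) (- 2 *\<^sub>R fst (snd v'))
                   + snd (snd v) \<le> - snd (snd v')}"
        using base[OF _ vv(2)] by (fastforce simp: algebra_simps)
      from K_half[OF this] vv(1) show ?thesis by auto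
    qed
    have "T \<subseteq> {w. inner (fst w) (2 *\<^sub>R fst v) + inner (fst (snd w)) (- 2 *\<^sub>R fst (snd v))
                   + snd (snd w) \<le> - snd (snd v)}"
      using step[OF that(1)] by (fastforce simp: algebra_simps inner_commute)
    from K_half[OF this] that(2) show ?thesis by (auto simp: inner_commute)
  qed
  define G where "G = (\<lambda>v::'a \<times> 'b \<times> real. snd (snd v) - (norm (fst (snd v)))\<^sup>2)"
  have G0: "G v \<le> 0" if "v \<in> K" for v
    using polar[OF that that] inner_ge_zero[of "fst v"] unfolding G_def power2_norm_eq_inner
    by linarith
  have Kne: "K \<noteq> {}" using ne unfolding K_def T_def by simp
  define m where "m = Sup (G ` K)"
  have bdd: "bdd_above (G ` K)" using G0 by (intro bdd_aboveI[of _ 0]) blast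
  have Gm: "G v \<le> m" if "v \<in> K" for v
    unfolding m_def using that bdd by (auto intro: cSup_upper)
  have m0: "m \<le> 0" unfolding m_def using Kne G0 by (auto intro: cSup_least)
  have "\<exists>v\<in>K. m - 1 / real (Suc k) < G v" for k
    using less_cSup_iff[of "G ` K" "m - 1 / real (Suc k)"] Kne bdd unfolding m_def by auto
  then obtain v where vK: "\<And>k. v k \<in> K" and vG: "\<And>k. m - 1 / real (Suc k) < G (v k)"
    by metis
  have cK: "convex K" unfolding K_def by simp
  define z where "z = (\<lambda>k. fst (snd (v k)))"
  define c where "c = (\<lambda>k. snd (snd (v k)))"
  have comb: "(1 - t) * c k + t * c' - (norm ((1 - t) *\<^sub>R z k + t *\<^sub>R z'))\<^sup>2 \<le> m"
    if "0 \<le> t" "t \<le> 1" "(w', z', c') \<in> K" for t k w' z' c'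
  proof -
    have "(1 - t) *\<^sub>R v k + t *\<^sub>R (w', z', c') \<in> K"
      using convexD[OF cK vK that(3), of "1 - t" t] that by auto
    from Gm[OF this] show ?thesis
      by (simp add: G_def z_def c_def)
  qed
  \<comment> \<open>Strong concavity: at the midpoint of two near-maximisers the function would gain a quarter of
    the squared distance of their components.\<close>
  have cauchy_est: "(norm (z k - z l))\<^sup>2 \<le> 2 / real (Suc k) + 2 / real (Suc l)" for k l
  proof -
    have "c k / 2 + c l / 2 - (norm ((1/2) *\<^sub>R z k + (1/2) *\<^sub>R z l))\<^sup>2 \<le> m"
      using comb[of "1/2" "fst (v l)" "z l" "c l" k] vK[of l] by (simp add: z_def c_def)
    moreover have "(norm ((1/2) *\<^sub>R z k + (1/2) *\<^sub>R z l))\<^sup>2 =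
        (norm (z k))\<^sup>2 / 2 + (norm (z l))\<^sup>2 / 2 - (norm (z k - z l))\<^sup>2 / 4"
      by (simp add: power2_norm_eq_inner inner_add_left inner_add_right inner_diff_left
          inner_diff_right inner_commute field_simps)
    moreover have "m - 1 / real (Suc k) < c k - (norm (z k))\<^sup>2" "m - 1 / real (Suc l) < c l - (norm (z l))\<^sup>2"
      using vG[of k] vG[of l] by (simp_all add: G_def z_def c_def)
    ultimately have "(norm (z k - z l))\<^sup>2 \<le> 2 * (1 / real (Suc k)) + 2 * (1 / real (Suc l))"
      by linarith
    then show ?thesis by simp
  qed
  have "Cauchy z"
  proof (rule metric_CauchyI)
    fix e :: real assume e: "0 < e"
    obtain N :: nat where N: "4 / e\<^sup>2 < real N" using reals_Archimedean2 by blast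
    have "dist (z k) (z l) < e" if "k \<ge> N" "l \<ge> N" for k l
    proof -
      have "2 / real (Suc k) \<le> 2 / real (Suc N)" "2 / real (Suc l) \<le> 2 / real (Suc N)"
        using that by (simp_all add: frac_le)
      moreover have "4 / real (Suc N) < e\<^sup>2"
      proof -
        have "4 < real N * e\<^sup>2" using N e by (simp add: divide_less_eq)
        also have "\<dots> \<le> real (Suc N) * e\<^sup>2" by (simp add: mult_right_mono)
        finally show ?thesis by (simp add: divide_less_eq mult.commute)
      qed
      ultimately have "(norm (z k - z l))\<^sup>2 < e\<^sup>2"
        using cauchy_est[of k l] by linarith
      then show ?thesis using e power2_less_imp_less[of "norm (z k - z l)" e] by (simp add: dist_norm)
    qed
    then show "\<exists>M. \<forall>k\<ge>M. \<forall>l\<ge>M. dist (z k) (z l) < e" by blast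
  qed
  then obtain y where zy: "z \<longlonglongrightarrow> y" using Cauchy_convergent convergent_def by blast
  have "(\<lambda>k. G (v k)) \<longlonglongrightarrow> m"
  proof (rule tendsto_sandwich[where f="\<lambda>k. m - 1 / real (Suc k)" and h="\<lambda>_. m"])
    show "(\<lambda>k. m - 1 / real (Suc k)) \<longlonglongrightarrow> m"
      using tendsto_diff[OF tendsto_const[of m] LIMSEQ_inverse_real_of_nat] by (simp add: inverse_eq_divide)
    show "\<forall>\<^sub>F k in sequentially. m - 1 / real (Suc k) \<le> G (v k)"
      using less_imp_le[OF vG] by (intro always_eventually allI)
  qed (use Gm vK in auto)
  then have "(\<lambda>k. G (v k) + (norm (z k))\<^sup>2) \<longlonglongrightarrow> m + (norm y)\<^sup>2"
    by (intro tendsto_intros zy)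
  then have cc: "c \<longlonglongrightarrow> m + (norm y)\<^sup>2" by (simp add: G_def z_def c_def)
  have "norm (y - q) \<le> norm p" if S: "(p, q) \<in> S" for p q
  proof -
    define c' where "c' = (norm q)\<^sup>2 - (norm p)\<^sup>2"
    have inK: "(p, q, c') \<in> K" unfolding K_def T_def c'_def
      by (rule hull_inc) (use S in force)
    have lim: "(1 - t) * (m + (norm y)\<^sup>2) + t * c' - (norm ((1 - t) *\<^sub>R y + t *\<^sub>R q))\<^sup>2 \<le> m"
      if t: "0 \<le> t" "t \<le> 1" for t
    proof (rule LIMSEQ_le_const2)
      show "(\<lambda>k. (1 - t) * c k + t * c' - (norm ((1 - t) *\<^sub>R z k + t *\<^sub>R q))\<^sup>2)
         \<longlonglongrightarrow> (1 - t) * (m + (norm y)\<^sup>2) + t * c' - (norm ((1 - t) *\<^sub>R y + t *\<^sub>R q))\<^sup>2"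
        by (intro tendsto_intros zy cc)
    qed (use comb[OF t inK] in auto)
    \<comment> \<open>Divide the inequality for the segment by \<open>t\<close>; the first-order condition is its limit at \<open>0\<close>.\<close>
    have small: "c' - m + (norm y)\<^sup>2 - 2 * inner y q \<le> t * (norm (y - q))\<^sup>2" if t: "0 < t" "t \<le> 1" for t
    proof -
      have "(norm ((1 - t) *\<^sub>R y + t *\<^sub>R q))\<^sup>2 =
         (norm y)\<^sup>2 - 2 * t * ((norm y)\<^sup>2 - inner y q) + t * (t * (norm (y - q))\<^sup>2)"
        by (simp add: power2_norm_eq_inner algebra_simps inner_commute)
      with lim[of t] t have "t * (c' - m + (norm y)\<^sup>2 - 2 * inner y q) \<le> t * (t * (norm (y - q))\<^sup>2)"
        by (simp add: algebra_simps)
      then show ?thesis using t by simp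
    qed
    have "c' - m + (norm y)\<^sup>2 - 2 * inner y q \<le> 0"
    proof (rule tendsto_lowerbound[where F="at_right 0" and f="\<lambda>t. t * (norm (y - q))\<^sup>2"])
      show "((\<lambda>t. t * (norm (y - q))\<^sup>2) \<longlongrightarrow> 0) (at_right 0)"
        by (auto intro!: tendsto_eq_intros)
      show "\<forall>\<^sub>F t in at_right 0. c' - m + (norm y)\<^sup>2 - 2 * inner y q \<le> t * (norm (y - q))\<^sup>2"
        unfolding eventually_at_right_field by (rule exI[of _ 1]) (use small in auto)
    qed simp
    then have "(norm (y - q))\<^sup>2 \<le> (norm p)\<^sup>2"
      using m0 unfolding c'_def by (simp add: power2_norm_eq_inner algebra_simps inner_commute)
    then show ?thesis by (rule power2_le_imp_le) simp
  qed
  then show ?thesis by auto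
qed

lemma monotone_opD:
  assumes "monotone_op B" "u \<in> B x" "v \<in> B y"
  shows "0 \<le> inner (x - y) (u - v)"
  using assms by (auto simp: monotone_op_def op_graph_def)

lemma maximal_monotone_memI:
  assumes max: "maximal_monotone_op B"
    and rel: "\<And>a b. b \<in> B a \<Longrightarrow> 0 \<le> inner (x - a) (u - b)"
  shows "u \<in> B x"
proof -
  define B' where "B' = B(x := insert u (B x))"
  have mono: "monotone_op B" using max by (simp add: maximal_monotone_op_def)
  have g: "op_graph B' = insert (x, u) (op_graph B)" by (auto simp: op_graph_def B'_def split: if_splits)
  have "0 \<le> inner (a - x) (b - u)" if "b \<in> B a" for a b
    using rel[OF that] by (metis inner_minus_left inner_minus_right minus_diff_eq minus_minus)
  then have "monotone_op B'"
    unfolding monotone_op_def g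
    using rel mono by (auto simp: op_graph_def monotone_opD)
  then have "op_graph B' = op_graph B"
    using max g unfolding maximal_monotone_op_def by blast
  then show ?thesis using g by (auto simp: op_graph_def)
qed

lemma maximal_monotone_nonempty:
  fixes B :: "'h::real_inner \<Rightarrow> 'h set"
  assumes "maximal_monotone_op B"
  obtains a b where "b \<in> B a"
  using maximal_monotone_memI[OF assms, of 0 0] by blast

text \<open>
  By maximality it suffices to find \<open>y\<close> such that \<open>(y, (x - y) / l)\<close> is monotonically related to the
  whole graph. Under the Cayley transform, which sends \<open>(a, b)\<close> to \<open>(a + l b, a - l b)\<close>, monotone
  operators become nonexpansive maps, and being related to the graph becomes being an extension of
  the nonexpansive map at the point \<open>x\<close>.
\<close>
theorem minty:
  fixes B :: "'h::{real_inner,banach} \<Rightarrow> 'h set"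
  assumes max: "maximal_monotone_op B" and l: "l > 0"
  shows "\<exists>y. (1 / l) *\<^sub>R (x - y) \<in> B y"
proof -
  have mono: "monotone_op B" using max by (simp add: maximal_monotone_op_def)
  define S where "S = {(a + l *\<^sub>R b - x, a - l *\<^sub>R b) | a b. b \<in> B a}"
  obtain a0 b0 where "b0 \<in> B a0" using maximal_monotone_nonempty[OF max] .
  then have "S \<noteq> {}" by (auto simp: S_def)
  moreover have "norm (q - q') \<le> norm (p - p')" if pq: "(p, q) \<in> S" "(p', q') \<in> S" for p q p' q'
  proof -
    obtain a b a' b' where ab: "b \<in> B a" "b' \<in> B a'" "p = a + l *\<^sub>R b - x" "q = a - l *\<^sub>R b"
      "p' = a' + l *\<^sub>R b' - x" "q' = a' - l *\<^sub>R b'"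
      using pq unfolding S_def by blast
    have "(norm (p - p'))\<^sup>2 - (norm (q - q'))\<^sup>2 = 4 * l * inner (a - a') (b - b')"
      unfolding ab by (simp add: power2_norm_eq_inner algebra_simps inner_commute)
    moreover have "0 \<le> 4 * l * inner (a - a') (b - b')"
      using monotone_opD[OF mono ab(1,2)] l by simp
    ultimately have "(norm (q - q'))\<^sup>2 \<le> (norm (p - p'))\<^sup>2" by linarith
    then show ?thesis by (rule power2_le_imp_le) simp
  qed
  ultimately have "\<exists>z. \<forall>(p, q)\<in>S. norm (z - q) \<le> norm p"
    by (rule kirszbraun_one_point)
  then obtain z where z: "norm (z - q) \<le> norm p" if "(p, q) \<in> S" for p q
    by blast
  define y where "y = (1/2) *\<^sub>R (x + z)"
  have zz: "z = 2 *\<^sub>R y - x" by (simp add: y_def)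
  have "(1 / l) *\<^sub>R (x - y) \<in> B y"
  proof (rule maximal_monotone_memI[OF max])
    fix a b assume "b \<in> B a"
    then have "norm (z - (a - l *\<^sub>R b)) \<le> norm (a + l *\<^sub>R b - x)"
      by (intro z) (auto simp: S_def)
    then have "(norm (z - (a - l *\<^sub>R b)))\<^sup>2 \<le> (norm (a + l *\<^sub>R b - x))\<^sup>2"
      by (rule power_mono) simp
    moreover have "(norm (a + l *\<^sub>R b - x))\<^sup>2 - (norm (z - (a - l *\<^sub>R b)))\<^sup>2
        = 4 * inner (y - a) ((x - y) - l *\<^sub>R b)"
      unfolding zz by (simp add: power2_norm_eq_inner algebra_simps inner_commute)
    moreover have "(x - y) - l *\<^sub>R b = l *\<^sub>R ((1 / l) *\<^sub>R (x - y) - b)"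
      using l by (simp add: algebra_simps)
    ultimately have "0 \<le> 4 * inner (y - a) (l *\<^sub>R ((1 / l) *\<^sub>R (x - y) - b))"
      by (metis diff_ge_0_iff_ge)
    then have "0 \<le> l * inner (y - a) ((1 / l) *\<^sub>R (x - y) - b)"
      by simp
    then show "0 \<le> inner (y - a) ((1 / l) *\<^sub>R (x - y) - b)"
      using l by (simp add: zero_le_mult_iff)
  qed
  then show ?thesis ..
qed

lemma resolvent_mem:
  fixes B :: "'h::{real_inner,banach} \<Rightarrow> 'h set"
  assumes max: "maximal_monotone_op B" and l: "l > 0"
  shows "(1 / l) *\<^sub>R (x - resolvent l B x) \<in> B (resolvent l B x)"
proof -
  have mono: "monotone_op B" using max by (simp add: maximal_monotone_op_def)
  have set_iff: "y \<in> resolvent_set l B x \<longleftrightarrow> (1 / l) *\<^sub>R (x - y) \<in> B y" for y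
  proof
    assume "y \<in> resolvent_set l B x"
    then obtain u where "u \<in> B y" "x = y + l *\<^sub>R u" unfolding resolvent_set_def by blast
    then show "(1 / l) *\<^sub>R (x - y) \<in> B y" using l by simp
  next
    assume "(1 / l) *\<^sub>R (x - y) \<in> B y"
    moreover have "x = y + l *\<^sub>R ((1 / l) *\<^sub>R (x - y))" using l by simp
    ultimately show "y \<in> resolvent_set l B x" unfolding resolvent_set_def by blast
  qed
  obtain y where y: "(1 / l) *\<^sub>R (x - y) \<in> B y" using minty[OF max l] by blast
  have "y' = y" if y': "(1 / l) *\<^sub>R (x - y') \<in> B y'" for y'
  proof -
    have "0 \<le> inner (y' - y) ((1 / l) *\<^sub>R (x - y') - (1 / l) *\<^sub>R (x - y))"
      by (rule monotone_opD[OF mono y' y])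
    also have "(1 / l) *\<^sub>R (x - y') - (1 / l) *\<^sub>R (x - y) = - (1 / l) *\<^sub>R (y' - y)"
      by (simp add: algebra_simps)
    also have "inner (y' - y) (- (1 / l) *\<^sub>R (y' - y)) = - (1 / l) * (norm (y' - y))\<^sup>2"
      by (simp add: power2_norm_eq_inner)
    finally show ?thesis using l by (simp add: divide_le_0_iff)
  qed
  then have "resolvent_set l B x = {y}"
    using y set_iff by blast
  then have "resolvent l B x = y" by (simp add: resolvent_def)
  with y show ?thesis by simp
qed

text \<open>
  Monotonicity between a graph point \<open>(y, v)\<close> and the graph point that the resolvent selects,
  multiplied by \<open>l\<close> so that it survives the limit \<open>l \<rightarrow> 0\<close>.
\<close>
lemma resolvent_inner:
  fixes B :: "'h::{real_inner,banach} \<Rightarrow> 'h set"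
  assumes max: "maximal_monotone_op B" and l: "l > 0" and v: "v \<in> B y"
  shows "l * inner v (resolvent l B x - y) \<le> inner (x - resolvent l B x) (resolvent l B x - y)"
proof -
  have mono: "monotone_op B" using max by (simp add: maximal_monotone_op_def)
  have "0 \<le> l * inner (resolvent l B x - y) ((1 / l) *\<^sub>R (x - resolvent l B x) - v)"
    using monotone_opD[OF mono resolvent_mem[OF max l] v] l by simp
  also have "\<dots> = inner (resolvent l B x - y) (l *\<^sub>R ((1 / l) *\<^sub>R (x - resolvent l B x) - v))"
    by simp
  also have "l *\<^sub>R ((1 / l) *\<^sub>R (x - resolvent l B x) - v) = (x - resolvent l B x) - l *\<^sub>R v"
    using l by (simp add: scaleR_diff_right)
  also have "inner (resolvent l B x - y) ((x - resolvent l B x) - l *\<^sub>R v) =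
      inner (x - resolvent l B x) (resolvent l B x - y) - l * inner v (resolvent l B x - y)"
    unfolding inner_commute[of "resolvent l B x - y"]
    by (simp only: inner_diff_left[of "x - resolvent l B x"] inner_scaleR_left)
  finally show ?thesis by simp
qed

lemma resolvent_nonexpansive:
  fixes B :: "'h::{real_inner,banach} \<Rightarrow> 'h set"
  assumes max: "maximal_monotone_op B" and l: "l > 0"
  shows "norm (resolvent l B x - resolvent l B y) \<le> norm (x - y)"
proof -
  let ?d = "resolvent l B x - resolvent l B y"
  have "inner (y - resolvent l B y) ?d \<le> inner (x - resolvent l B x) ?d"
    using resolvent_inner[OF max l resolvent_mem[OF max l, of y], of x] l by simp
  then have "(norm ?d)\<^sup>2 \<le> inner (x - y) ?d"
    by (simp add: power2_norm_eq_inner inner_diff_left)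
  also have "\<dots> \<le> norm (x - y) * norm ?d" by (rule norm_cauchy_schwarz)
  finally show ?thesis
    by (simp add: power2_eq_square mult_le_cancel_right) (use norm_ge_zero in force)
qed

text \<open>
  The term linear in \<open>l\<close> involves \<open>x\<close> and not the resolvent, so it averages to zero when \<open>v\<close> is
  replaced by a selection of mean zero. The price is the term in \<open>l\<^sup>2\<close>, obtained by completing the
  square with the displacement \<open>x - resolvent l B x\<close>.
\<close>
lemma resolvent_descent:
  fixes B :: "'h::{real_inner,banach} \<Rightarrow> 'h set"
  assumes max: "maximal_monotone_op B" and l: "l > 0" and v: "v \<in> B y"
  shows "(norm (resolvent l B x - y))\<^sup>2 \<le> (norm (x - y))\<^sup>2 - 2 * l * inner v (x - y) + l\<^sup>2 * (norm v)\<^sup>2"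
proof -
  have id: "(norm (d + e))\<^sup>2 - 2 * l * inner v (d + e) + l\<^sup>2 * (norm v)\<^sup>2 - (norm e)\<^sup>2
      = (norm (d - l *\<^sub>R v))\<^sup>2 + 2 * (inner d e - l * inner v e)" for d e :: 'h
  proof -
    have "inner (d + e) (d + e) = inner d d + 2 * inner d e + inner e e"
      by (simp add: inner_add_left inner_add_right inner_commute)
    moreover have "inner (d - l *\<^sub>R v) (d - l *\<^sub>R v) = inner d d - 2 * (l * inner v d) + l * (l * inner v v)"
      by (simp add: inner_diff_left inner_diff_right inner_commute)
    moreover have "l * inner v (d + e) = l * inner v d + l * inner v e"
      by (simp add: inner_add_right distrib_left)
    ultimately show ?thesis
      unfolding power2_norm_eq_inner power2_eq_square[of l] mult.assoc
      by (simp only:) (simp add: right_diff_distrib)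
  qed
  have "0 \<le> inner (x - resolvent l B x) (resolvent l B x - y) - l * inner v (resolvent l B x - y)"
    unfolding diff_ge_0_iff_ge by (rule resolvent_inner[OF max l v])
  moreover have "(x - resolvent l B x) + (resolvent l B x - y) = x - y" by simp
  ultimately show ?thesis
    using id[of "x - resolvent l B x" "resolvent l B x - y"]
      zero_le_power2[of "norm (x - resolvent l B x - l *\<^sub>R v)"]
    by (simp only:) argo
qed

section \<open>Recursions driven by independent identically distributed noise\<close>

text \<open>
  Replacing the second argument by the first point within \<open>1 / (k + 1)\<close> in a dense sequence gives
  a measurable function, since that point takes countably many values; continuity lets \<open>k\<close> tend to
  infinity.
\<close>
lemma borel_measurable_Caratheodory:
  fixes f :: "'a \<Rightarrow> 'b::{metric_space, second_countable_topology} \<Rightarrow> 'c::metric_space"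
  assumes meas: "\<And>x. (\<lambda>s. f s x) \<in> borel_measurable M"
    and cont: "\<And>s. s \<in> space M \<Longrightarrow> continuous_on UNIV (f s)"
  shows "(\<lambda>p. f (fst p) (snd p)) \<in> borel_measurable (M \<Otimes>\<^sub>M borel)"
proof -
  obtain D :: "'b set" where D: "countable D" "\<And>X. open X \<Longrightarrow> X \<noteq> {} \<Longrightarrow> \<exists>d\<in>D. d \<in> X"
    by (erule countable_dense_setE)
  then have "D \<noteq> {}" using open_UNIV by blast
  define q where "q = from_nat_into D"
  have q: "\<exists>i. dist x (q i) < e" if e: "e > 0" for x e
  proof -
    obtain d where "d \<in> D" "d \<in> ball x e" using D(2)[of "ball x e"] e centre_in_ball[of x e] open_ball[of x e] by blast
    moreover obtain i where "d = q i"
      using \<open>d \<in> D\<close> D(1) \<open>D \<noteq> {}\<close> unfolding q_def by (metis from_nat_into_surj)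
    ultimately show ?thesis by auto
  qed
  define i where "i = (\<lambda>k x. LEAST i. dist x (q i) < 1 / real (Suc k))"
  have i: "dist x (q (i k x)) < 1 / real (Suc k)" for k x
    unfolding i_def by (rule LeastI_ex) (rule q, simp)
  show ?thesis
  proof (rule borel_measurable_LIMSEQ_metric)
    fix k
    have [measurable]: "i k \<in> borel \<rightarrow>\<^sub>M count_space UNIV"
      unfolding i_def by measurable
    note meas[measurable]
    show "(\<lambda>p. f (fst p) (q (i k (snd p)))) \<in> borel_measurable (M \<Otimes>\<^sub>M borel)"
      by (rule measurable_compose_countable[of "\<lambda>j p. f (fst p) (q j)"]) measurable
  next
    fix p assume "p \<in> space (M \<Otimes>\<^sub>M (borel :: 'b measure))"
    then have "isCont (f (fst p)) (snd p)"
      using cont[of "fst p"] by (auto simp: space_pair_measure continuous_on_eq_continuous_at)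
    moreover have "(\<lambda>k. q (i k (snd p))) \<longlonglongrightarrow> snd p"
    proof (rule metric_LIMSEQ_I)
      fix r :: real assume "0 < r"
      then obtain n0 where n0: "1 / real (Suc n0) < r"
        using nat_approx_posE by blast
      have "dist (q (i k (snd p))) (snd p) < r" if "k \<ge> n0" for k
      proof -
        have "1 / real (Suc k) \<le> 1 / real (Suc n0)" using that by (simp add: frac_le)
        then show ?thesis using i[of "snd p" k] n0 by (simp add: dist_commute)
      qed
      then show "\<exists>n0. \<forall>k\<ge>n0. dist (q (i k (snd p))) (snd p) < r" by blast
    qed
    ultimately show "(\<lambda>k. f (fst p) (q (i k (snd p)))) \<longlonglongrightarrow> f (fst p) (snd p)"
      by (rule isCont_tendsto_compose)
  qed
qed

text \<open>
  The noise sequence is an argument of its own, so that a path is visibly a function of the noise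
  up to the current time; the first noise variable used has index \<open>1\<close>.
\<close>
primrec driven :: "(nat \<Rightarrow> 'z \<times> 'e \<Rightarrow> 'z) \<Rightarrow> 'z \<Rightarrow> (nat \<Rightarrow> 'e) \<Rightarrow> nat \<Rightarrow> 'z" where
  "driven F z h 0 = z"
| "driven F z h (Suc n) = F n (driven F z h n, h (Suc n))"

lemma driven_restrict:
  "n \<le> m \<Longrightarrow> driven F z (restrict h {1..m}) n = driven F z h n"
  by (induction n) auto

lemma measurable_driven_PiM:
  assumes F: "\<And>n. F n \<in> S \<Otimes>\<^sub>M N \<rightarrow>\<^sub>M S" and z: "z \<in> space S" and n: "n \<le> m"
  shows "(\<lambda>h. driven F z h n) \<in> PiM {1..m} (\<lambda>_. N) \<rightarrow>\<^sub>M S"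
  using n
proof (induction n)
  case 0
  then show ?case using z by simp
next
  case (Suc n)
  have "(\<lambda>h. h (Suc n)) \<in> PiM {1..m} (\<lambda>_. N) \<rightarrow>\<^sub>M N"
    using Suc.prems by (intro measurable_component_singleton) auto
  then show ?case
    using Suc by (simp add: measurable_compose[OF _ F] measurable_Pair)
qed

context prob_space
begin

lemma measurable_driven:
  assumes ind: "indep_vars (\<lambda>_. N) \<xi> {1..}"
    and F: "\<And>n. F n \<in> S \<Otimes>\<^sub>M N \<rightarrow>\<^sub>M S" and z: "z \<in> space S"
  shows "(\<lambda>w. driven F z (\<lambda>i. \<xi> i w) n) \<in> M \<rightarrow>\<^sub>M S"
proof (induction n)
  case 0
  then show ?case using z by simp
next
  case (Suc n)
  have "\<xi> (Suc n) \<in> M \<rightarrow>\<^sub>M N" using ind unfolding indep_vars_def by auto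
  with Suc show ?case by (simp add: measurable_compose[OF _ F] measurable_Pair)
qed

text \<open>
  The Markov property: the state at time \<open>n\<close> is a function of the noise up to time \<open>n\<close> and is
  therefore independent of the next noise variable, which can be integrated out first.
\<close>
lemma nn_integral_driven_step:
  assumes ind: "indep_vars (\<lambda>_. N) \<xi> {1..}"
    and law: "\<And>n. n \<ge> 1 \<Longrightarrow> distr M N (\<xi> n) = N"
    and F: "\<And>n. F n \<in> S \<Otimes>\<^sub>M N \<rightarrow>\<^sub>M S" and z: "z \<in> space S"
    and f: "f \<in> borel_measurable (S \<Otimes>\<^sub>M N)"
  shows "(\<integral>\<^sup>+ w. f (driven F z (\<lambda>i. \<xi> i w) n, \<xi> (Suc n) w) \<partial>M)
       = (\<integral>\<^sup>+ w. (\<integral>\<^sup>+ s. f (driven F z (\<lambda>i. \<xi> i w) n, s) \<partial>N) \<partial>M)"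
proof -
  define past where "past = (\<lambda>w. restrict (\<lambda>i. \<xi> i w) {1..n})"
  define now where "now = (\<lambda>w. restrict (\<lambda>i. \<xi> i w) {Suc n})"
  define A where "A = PiM {1..n} (\<lambda>_. N)"
  define B where "B = PiM {Suc n} (\<lambda>_. N)"
  have X[measurable]: "\<xi> (Suc n) \<in> M \<rightarrow>\<^sub>M N" using ind unfolding indep_vars_def by auto
  interpret N: prob_space N
    using prob_space_distr[OF X] law[of "Suc n"] by simp
  \<comment> \<open>Independence is stated for the restricted noise sequences, because the predicate for two
    variables requires a common value type.\<close>
  have iv: "indep_var A past B now"
    unfolding past_def now_def A_def B_def by (rule indep_var_restrict[OF ind]) auto
  then have past[measurable]: "past \<in> M \<rightarrow>\<^sub>M A" and now[measurable]: "now \<in> M \<rightarrow>\<^sub>M B"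
    and eq: "distr M A past \<Otimes>\<^sub>M distr M B now = distr M (A \<Otimes>\<^sub>M B) (\<lambda>w. (past w, now w))"
    unfolding indep_var_distribution_eq by auto
  interpret B: prob_space "distr M B now" by (rule prob_space_distr[OF now])
  have g[measurable]: "(\<lambda>h. driven F z h n) \<in> A \<rightarrow>\<^sub>M S"
    unfolding A_def by (rule measurable_driven_PiM[OF F z order_refl])
  have c[measurable]: "(\<lambda>h. h (Suc n)) \<in> B \<rightarrow>\<^sub>M N"
    unfolding B_def by (rule measurable_component_singleton) simp
  note f[measurable]
  have at_now: "now w (Suc n) = \<xi> (Suc n) w" for w by (simp add: now_def)
  have path: "driven F z (past w) n = driven F z (\<lambda>i. \<xi> i w) n" for w
    unfolding past_def by (rule driven_restrict) simp
  have "(\<integral>\<^sup>+ w. f (driven F z (\<lambda>i. \<xi> i w) n, \<xi> (Suc n) w) \<partial>M)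
      = (\<integral>\<^sup>+ w. f (driven F z (past w) n, now w (Suc n)) \<partial>M)"
    unfolding path at_now ..
  also have "\<dots> = (\<integral>\<^sup>+ p. f (driven F z (fst p) n, snd p (Suc n)) \<partial>(distr M A past \<Otimes>\<^sub>M distr M B now))"
    unfolding eq by (subst nn_integral_distr) auto
  also have "\<dots> = (\<integral>\<^sup>+ a. \<integral>\<^sup>+ b. f (driven F z a n, b (Suc n)) \<partial>distr M B now \<partial>distr M A past)"
    by (subst B.nn_integral_fst[symmetric]) auto
  also have "\<dots> = (\<integral>\<^sup>+ a. \<integral>\<^sup>+ s. f (driven F z a n, s) \<partial>N \<partial>distr M A past)"
  proof (rule nn_integral_cong)
    fix a assume "a \<in> space (distr M A past)"
    then have "driven F z a n \<in> space S" using measurable_space[OF g] by simp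
    then have [measurable]: "(\<lambda>s. f (driven F z a n, s)) \<in> borel_measurable N"
      by measurable
    have "(\<integral>\<^sup>+ b. f (driven F z a n, b (Suc n)) \<partial>distr M B now)
        = (\<integral>\<^sup>+ w. f (driven F z a n, \<xi> (Suc n) w) \<partial>M)"
      by (subst nn_integral_distr) (auto simp: at_now)
    also have "\<dots> = (\<integral>\<^sup>+ s. f (driven F z a n, s) \<partial>distr M N (\<xi> (Suc n)))"
      by (subst nn_integral_distr) auto
    finally show "(\<integral>\<^sup>+ b. f (driven F z a n, b (Suc n)) \<partial>distr M B now)
        = (\<integral>\<^sup>+ s. f (driven F z a n, s) \<partial>N)"
      by (simp add: law)
  qed
  also have "\<dots> = (\<integral>\<^sup>+ w. (\<integral>\<^sup>+ s. f (driven F z (past w) n, s) \<partial>N) \<partial>M)"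
    by (subst nn_integral_distr) auto
  finally show ?thesis unfolding path .
qed

lemma nn_integral_driven_decreasing:
  assumes ind: "indep_vars (\<lambda>_. N) \<xi> {1..}"
    and law: "\<And>n. n \<ge> 1 \<Longrightarrow> distr M N (\<xi> n) = N"
    and F: "\<And>n. F n \<in> S \<Otimes>\<^sub>M N \<rightarrow>\<^sub>M S" and z: "z \<in> space S"
    and W: "\<And>n. W n \<in> borel_measurable S"
    and drift: "\<And>n y. y \<in> space S \<Longrightarrow> (\<integral>\<^sup>+ s. W (Suc n) (F n (y, s)) \<partial>N) \<le> W n y"
  shows "(\<integral>\<^sup>+ w. W n (driven F z (\<lambda>i. \<xi> i w) n) \<partial>M) \<le> W 0 z"
proof (induction n)
  case 0
  then show ?case by (simp add: emeasure_space_1)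
next
  case (Suc n)
  have "(\<integral>\<^sup>+ w. W (Suc n) (driven F z (\<lambda>i. \<xi> i w) (Suc n)) \<partial>M)
     = (\<integral>\<^sup>+ w. (\<integral>\<^sup>+ s. W (Suc n) (F n (driven F z (\<lambda>i. \<xi> i w) n, s)) \<partial>N) \<partial>M)"
    using nn_integral_driven_step[where F=F, OF ind law F z, where f="\<lambda>p. W (Suc n) (F n p)"]
      measurable_compose[OF F W] by simp
  also have "\<dots> \<le> (\<integral>\<^sup>+ w. W n (driven F z (\<lambda>i. \<xi> i w) n) \<partial>M)"
    using measurable_space[OF measurable_driven[where F=F, OF ind F z]]
    by (intro nn_integral_mono drift) auto
  finally show ?case using Suc.IH by simp
qed

text \<open>
  Ville's maximal inequality in qualitative form. For a level \<open>c\<close>, the state is enlarged by a flag: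
  \<open>0\<close> while the path is running, \<open>2\<close> once \<open>W\<close> has reached \<open>c\<close>, and \<open>1\<close> once the path has left \<open>G\<close>
  before that. Freezing \<open>W\<close> at \<open>c\<close> in the second case and at \<open>0\<close> in the third yields a process whose
  drift is nonpositive everywhere, so its mean stays below \<open>W 0 z\<close>, and Markov's inequality bounds
  the probability of ever reaching \<open>c\<close> by \<open>W 0 z / c\<close>. Working with the enlarged chain replaces
  filtrations, stopping times and conditional expectations.
\<close>
lemma driven_supermartingale_bounded:
  fixes W :: "nat \<Rightarrow> 'z \<Rightarrow> ennreal"
  assumes ind: "indep_vars (\<lambda>_. N) \<xi> {1..}"
    and law: "\<And>n. n \<ge> 1 \<Longrightarrow> distr M N (\<xi> n) = N"
    and F: "\<And>n. F n \<in> S \<Otimes>\<^sub>M N \<rightarrow>\<^sub>M S" and z: "z \<in> space S"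
    and W: "\<And>n. W n \<in> borel_measurable S"
    and G: "G \<in> sets S"
    and drift: "\<And>n y. y \<in> G \<Longrightarrow> (\<integral>\<^sup>+ s. W (Suc n) (F n (y, s)) \<partial>N) \<le> W n y"
    and fin: "W 0 z < \<infinity>"
  shows "AE w in M. (\<forall>n. driven F z (\<lambda>i. \<xi> i w) n \<in> G) \<longrightarrow>
           (\<exists>c. \<forall>n. W n (driven F z (\<lambda>i. \<xi> i w) n) < of_nat c)"
proof -
  note [measurable] = F W G
  define S' where "S' = S \<Otimes>\<^sub>M (count_space (UNIV :: nat set))"
  define flag :: "nat \<Rightarrow> nat \<Rightarrow> 'z \<times> nat \<Rightarrow> nat" where
    "flag c n y = (if snd y \<noteq> 0 then snd y else if W n (fst y) \<ge> of_nat c then 2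
      else if fst y \<in> G then 0 else 1)" for c n y
  define F' where "F' c n = (\<lambda>(y, s). (F n (fst y, s), flag c n y))" for c n
  define W' :: "nat \<Rightarrow> nat \<Rightarrow> 'z \<times> nat \<Rightarrow> ennreal" where
    "W' c n y = (if snd y = 0 then W n (fst y) else if snd y = 1 then 0 else of_nat c)" for c n y
  define Z where "Z w n = driven F z (\<lambda>i. \<xi> i w) n" for w n
  define Z' where "Z' c w n = driven (F' c) (z, 0) (\<lambda>i. \<xi> i w) n" for c w n
  have fstZ': "fst (Z' c w n) = Z w n" for c w n
    unfolding Z_def Z'_def by (induction n) (auto simp: F'_def)
  have sndZ': "snd (Z' c w (Suc n)) = flag c n (Z' c w n)" for c w n
    unfolding Z'_def by (simp add: F'_def)
  have flagm[measurable]: "flag c n \<in> S' \<rightarrow>\<^sub>M count_space UNIV" for c n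
    unfolding flag_def S'_def by measurable
  have F': "F' c n \<in> S' \<Otimes>\<^sub>M N \<rightarrow>\<^sub>M S'" for c n
  proof -
    have "(\<lambda>p. (F n (fst (fst p), snd p), flag c n (fst p)))
        \<in> S' \<Otimes>\<^sub>M N \<rightarrow>\<^sub>M (S \<Otimes>\<^sub>M count_space UNIV)"
      using flagm[of c n] unfolding S'_def by measurable
    then show ?thesis by (simp add: F'_def S'_def case_prod_beta')
  qed
  have z': "(z, 0) \<in> space S'" using z by (simp add: S'_def space_pair_measure)
  have W': "W' c n \<in> borel_measurable S'" for c n
    unfolding W'_def S'_def by measurable
  have X: "\<xi> 1 \<in> M \<rightarrow>\<^sub>M N" using ind unfolding indep_vars_def by auto
  interpret N: prob_space N
    using prob_space_distr[OF X] law[of 1] by simp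
  have drift': "(\<integral>\<^sup>+ s. W' c (Suc n) (F' c n (y, s)) \<partial>N) \<le> W' c n y" if "y \<in> space S'" for c n y
  proof -
    have *: "W' c (Suc n) (F' c n (y, s)) = (if flag c n y = 0 then W (Suc n) (F n (fst y, s))
        else if flag c n y = 1 then 0 else of_nat c)" for s
      by (simp add: W'_def F'_def)
    show ?thesis
      unfolding * using drift[of "fst y" n]
      by (auto simp: W'_def flag_def N.emeasure_space_1)
  qed
  have bound: "(\<integral>\<^sup>+ w. W' c n (Z' c w n) \<partial>M) \<le> W 0 z" for c n
    using nn_integral_driven_decreasing[where F="F' c" and W="W' c", OF ind law F' z' W' drift', of n]
    by (simp add: Z'_def W'_def)
  have Zm[measurable]: "(\<lambda>w. Z' c w n) \<in> M \<rightarrow>\<^sub>M S'" for c n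
    unfolding Z'_def by (rule measurable_driven[where F="F' c", OF ind F' z'])
  have [measurable]: "(\<lambda>w. snd (Z' c w n)) \<in> M \<rightarrow>\<^sub>M count_space UNIV" for c n
    using Zm[of c n] unfolding S'_def by measurable
  define H where "H c n = {w \<in> space M. snd (Z' c w n) = 2}" for c n
  have [measurable]: "H c n \<in> sets M" for c n unfolding H_def by measurable
  have "of_nat c * emeasure M (H c n) \<le> W 0 z" for c n
  proof -
    have "of_nat c * emeasure M (H c n) = (\<integral>\<^sup>+ w. of_nat c * indicator (H c n) w \<partial>M)"
      by (simp add: nn_integral_cmult)
    also have "\<dots> \<le> (\<integral>\<^sup>+ w. W' c n (Z' c w n) \<partial>M)"
      by (intro nn_integral_mono) (auto simp: H_def W'_def indicator_def)
    finally show ?thesis using bound[of c n] by simp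
  qed
  moreover have incs: "incseq (H c)" for c
    by (rule incseq_SucI) (auto simp: H_def sndZ' flag_def)
  ultimately have hit: "of_nat c * emeasure M (\<Union>n. H c n) \<le> W 0 z" for c
    by (subst SUP_emeasure_incseq[symmetric]) (auto simp: SUP_mult_left_ennreal intro: SUP_least)
  define B where "B = (\<Inter>c. \<Union>n. H c n)"
  have Bm: "B \<in> sets M" unfolding B_def by measurable
  have "emeasure M B = 0"
  proof -
    have "real c * measure M B \<le> enn2real (W 0 z)" for c
    proof -
      have "of_nat c * emeasure M B \<le> of_nat c * emeasure M (\<Union>n. H c n)"
        by (intro mult_left_mono emeasure_mono) (auto simp: B_def)
      then have "of_nat c * emeasure M B \<le> W 0 z" using hit[of c] by simp
      then have "enn2real (of_nat c * emeasure M B) \<le> enn2real (W 0 z)"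
        using fin by (intro enn2real_mono) auto
      then show ?thesis by (simp add: enn2real_mult measure_def)
    qed
    then have "measure M B = 0"
      by (metis measure_nonneg not_le order_le_less reals_Archimedean3)
    then show ?thesis by (simp add: emeasure_eq_measure)
  qed
  then have "B \<in> null_sets M" using Bm by auto
  moreover have "w \<in> B"
    if w: "w \<in> space M" "\<forall>n. Z w n \<in> G" "\<not> (\<exists>c. \<forall>n. W n (Z w n) < of_nat c)" for w
  proof -
    have "\<exists>n. w \<in> H c n" for c
    proof -
      obtain n where n: "of_nat c \<le> W n (Z w n)" using w(3) by (auto simp: not_less)
      have "snd (Z' c w n) = 0 \<or> snd (Z' c w n) = 2" for n
      proof (induction n)
        case 0
        then show ?case by (simp add: Z'_def)
      next
        case (Suc n)
        then show ?case using w(2) by (auto simp: sndZ' flag_def fstZ')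
      qed
      then have "snd (Z' c w (Suc n)) = 2"
        using n by (metis fstZ' sndZ' flag_def)
      then show ?thesis using w(1) unfolding H_def by blast
    qed
    then show ?thesis by (auto simp: B_def)
  qed
  ultimately show ?thesis
    unfolding Z_def[symmetric] by (intro AE_I'[of B]) blast+
qed

end

lemma set_edist_le: "y \<in> Q \<Longrightarrow> set_edist x Q \<le> ennreal (norm (x - y))"
  unfolding set_edist_def by (rule INF_lower)

section \<open>Mean square estimates for one resolvent step\<close>

lemma infdist_lessE:
  assumes "infdist x Q < t" "Q \<noteq> {}"
  obtains y where "y \<in> Q" "dist x y < t"
proof -
  have "(INF y\<in>Q. dist x y) < t" using assms by (simp add: infdist_def)
  moreover have "bdd_below (dist x ` Q)" by (rule bdd_belowI[of _ 0]) auto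
  ultimately show ?thesis using assms(2) that by (auto simp: cINF_less_iff)
qed

lemma set_edist_eq_infdist:
  assumes "Q \<noteq> {}"
  shows "set_edist x Q = ennreal (infdist x Q)"
proof (rule antisym)
  show "ennreal (infdist x Q) \<le> set_edist x Q"
    unfolding set_edist_def
    by (rule INF_greatest) (auto intro!: ennreal_leI infdist_le simp: dist_norm[symmetric])
  show "set_edist x Q \<le> ennreal (infdist x Q)"
  proof (rule ennreal_le_epsilon)
    fix e :: real assume e: "0 < e"
    have "infdist x Q < infdist x Q + e" using e by simp
    then obtain y where y: "y \<in> Q" "dist x y < infdist x Q + e"
      using infdist_lessE[OF _ assms] by blast
    have "set_edist x Q \<le> ennreal (dist x y)" using set_edist_le[OF y(1)] by (simp add: dist_norm)
    also have "\<dots> \<le> ennreal (infdist x Q + e)" using y by (intro ennreal_leI) simp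
    also have "\<dots> = ennreal (infdist x Q) + ennreal e"
      using e infdist_nonneg by (intro ennreal_plus) auto
    finally show "set_edist x Q \<le> ennreal (infdist x Q) + ennreal e" .
  qed
qed

text \<open>
  The limit \<open>q\<close> of the resolvents is the projection of \<open>x\<close> onto the closure of the domain. Both
  inequalities are the limit, as the parameter tends to \<open>0\<close>, of what monotonicity says about the
  resolvents.
\<close>
lemma resolvent_limit_inequalities:
  fixes B :: "'h::{real_inner,banach} \<Rightarrow> 'h set"
  assumes max: "maximal_monotone_op B"
    and l: "\<And>k. l k > 0" "l \<longlonglongrightarrow> 0"
    and q: "(\<lambda>k. resolvent (l k) B x) \<longlonglongrightarrow> q"
  shows "set_edist x (op_dom B) \<le> ennreal (norm (x - q))"
    and "y \<in> op_dom B \<Longrightarrow> (norm (q - y))\<^sup>2 + (norm (x - q))\<^sup>2 \<le> (norm (x - y))\<^sup>2"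
proof -
  have "resolvent (l k) B x \<in> op_dom B" for k
    using resolvent_mem[OF max l(1), of k x] by (auto simp: op_dom_def)
  then have "set_edist x (op_dom B) \<le> ennreal (norm (x - resolvent (l k) B x))" for k
    by (rule set_edist_le)
  moreover have "(\<lambda>k. ennreal (norm (x - resolvent (l k) B x))) \<longlonglongrightarrow> ennreal (norm (x - q))"
    by (intro tendsto_intros q tendsto_ennrealI)
  ultimately show "set_edist x (op_dom B) \<le> ennreal (norm (x - q))"
    by (intro LIMSEQ_le_const[where X="\<lambda>k. ennreal (norm (x - resolvent (l k) B x))"]) blast+
next
  assume "y \<in> op_dom B"
  then obtain v where v: "v \<in> B y" by (auto simp: op_dom_def)
  have "0 * inner v (q - y) \<le> inner (x - q) (q - y)"
  proof (rule LIMSEQ_le)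
    show "(\<lambda>k. l k * inner v (resolvent (l k) B x - y)) \<longlonglongrightarrow> 0 * inner v (q - y)"
      by (intro tendsto_intros q l(2))
    show "(\<lambda>k. inner (x - resolvent (l k) B x) (resolvent (l k) B x - y)) \<longlonglongrightarrow> inner (x - q) (q - y)"
      by (intro tendsto_intros q)
  qed (use resolvent_inner[OF max l(1) v] in auto)
  moreover have "(norm (x - y))\<^sup>2 = (norm (q - y))\<^sup>2 + (norm (x - q))\<^sup>2 + 2 * inner (x - q) (q - y)"
    using dot_norm[of "x - q" "q - y"] by simp
  ultimately show "(norm (q - y))\<^sup>2 + (norm (x - q))\<^sup>2 \<le> (norm (x - y))\<^sup>2" by simp
qed

lemma (in prob_space) resolvent_mean_square_le:
  fixes A :: "'a \<Rightarrow> 'h::{real_inner, banach, second_countable_topology} \<Rightarrow> 'h set"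
  assumes max: "AE s in M. maximal_monotone_op (A s)" and l: "l > 0"
    and sel: "AE s in M. \<phi> s \<in> A s y" and zero: "has_bochner_integral M \<phi> 0"
    and sq: "integrable M (\<lambda>s. (norm (\<phi> s))\<^sup>2)"
  shows "(\<integral>\<^sup>+ s. ennreal ((norm (resolvent l (A s) x - y))\<^sup>2) \<partial>M)
       \<le> ennreal ((norm (x - y))\<^sup>2 + l\<^sup>2 * (\<integral> s. (norm (\<phi> s))\<^sup>2 \<partial>M))"
proof -
  define g where "g s = (norm (x - y))\<^sup>2 - 2 * l * inner (\<phi> s) (x - y) + l\<^sup>2 * (norm (\<phi> s))\<^sup>2" for s
  have phi: "integrable M \<phi>" "integral\<^sup>L M \<phi> = 0"
    using zero by (simp_all add: has_bochner_integral_iff)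
  have gint: "integrable M g" unfolding g_def using phi sq by simp
  have le: "AE s in M. (norm (resolvent l (A s) x - y))\<^sup>2 \<le> g s"
    using max sel by eventually_elim (auto simp: g_def intro: resolvent_descent[OF _ l])
  have "(\<integral>\<^sup>+ s. ennreal ((norm (resolvent l (A s) x - y))\<^sup>2) \<partial>M) \<le> (\<integral>\<^sup>+ s. ennreal (g s) \<partial>M)"
    using le by (intro nn_integral_mono_AE) (auto intro: ennreal_leI)
  also have "\<dots> = ennreal (integral\<^sup>L M g)"
  proof (rule nn_integral_eq_integral[OF gint])
    show "AE s in M. 0 \<le> g s" using le by eventually_elim (meson order_trans zero_le_power2)
  qed
  also have "integral\<^sup>L M g = (norm (x - y))\<^sup>2 + l\<^sup>2 * (\<integral> s. (norm (\<phi> s))\<^sup>2 \<partial>M)"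
    unfolding g_def using phi sq by (simp add: prob_space)
  finally show ?thesis .
qed

lemma power2_sum_le_weighted:
  fixes a b k :: real
  assumes "k > 0"
  shows "(a + b)\<^sup>2 \<le> (1 + k) * a\<^sup>2 + (1 + 1 / k) * b\<^sup>2"
proof -
  have "0 \<le> (sqrt k * a - b / sqrt k)\<^sup>2" by simp
  also have "\<dots> = k * a\<^sup>2 + b\<^sup>2 / k - 2 * a * b"
    using assms by (simp add: power2_diff power_mult_distrib power_divide)
  finally show ?thesis by (simp add: power2_sum algebra_simps)
qed

text \<open>
  The contraction towards the essential domain. For a point \<open>y\<close> of the essential domain and the
  limit \<open>q s\<close> of the resolvents, the distance of \<open>q s\<close> to \<open>y\<close> satisfies
  \<open>norm (q s - y) ^ 2 \<le> norm (x - y) ^ 2 - norm (x - q s) ^ 2\<close>, and the separation hypothesis bounds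
  the mean of the subtracted term below by \<open>\<kappa> d(x)^2\<close>. Passing from \<open>q s\<close> to the resolvent costs
  the error \<open>l * c s\<close>; the splitting of the square with weight \<open>\<kappa>\<close> keeps the factor
  \<open>(1 + \<kappa>) (1 - \<kappa>) = 1 - \<kappa>\<^sup>2\<close> below one. Since \<open>x\<close> is fixed, the estimate may be optimised
  over \<open>y\<close> after the integration.

  The function \<open>\<pi>\<close> may be nonmeasurable: it serves only to force the convergence of the resolvents,
  and is replaced by their measurable limit.
\<close>
lemma (in prob_space) resolvent_infdist_mean_square_le:
  fixes A :: "'a \<Rightarrow> 'h::{real_inner, banach, second_countable_topology} \<Rightarrow> 'h set"
  assumes max: "AE s in M. maximal_monotone_op (A s)"
    and meas: "\<And>l. l > 0 \<Longrightarrow> (\<lambda>s. resolvent l (A s) x) \<in> borel_measurable M"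
    and near: "\<And>l. l > 0 \<Longrightarrow> AE s in M. norm (resolvent l (A s) x - \<pi> s) \<le> l * c s"
    and csq: "integrable M (\<lambda>s. (c s)\<^sup>2)"
    and ne: "essential_domain M A \<noteq> {}"
    and k: "0 < \<kappa>"
      "ennreal \<kappa> * (set_edist x (essential_domain M A))\<^sup>2 \<le> (\<integral>\<^sup>+ s. (set_edist x (op_dom (A s)))\<^sup>2 \<partial>M)"
    and l: "l > 0"
  shows "(\<integral>\<^sup>+ s. ennreal ((infdist (resolvent l (A s) x) (essential_domain M A))\<^sup>2) \<partial>M)
    \<le> ennreal ((1 - \<kappa>\<^sup>2) * (infdist x (essential_domain M A))\<^sup>2
         + (1 + 1 / \<kappa>) * (l\<^sup>2 * (\<integral> s. (c s)\<^sup>2 \<partial>M)))"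
proof -
  define D where "D = essential_domain M A"
  define d where "d = infdist x D"
  define E where "E = (1 + 1 / \<kappa>) * (l\<^sup>2 * (\<integral> s. (c s)\<^sup>2 \<partial>M))"
  define a where "a s = (infdist (resolvent l (A s) x) D)\<^sup>2" for s
  define r where "r k = 1 / real (Suc k)" for k
  have r: "r k > 0" for k by (simp add: r_def)
  have r0: "r \<longlonglongrightarrow> 0" unfolding r_def using LIMSEQ_inverse_real_of_nat by (simp add: inverse_eq_divide)
  define q where "q s = lim (\<lambda>k. resolvent (r k) (A s) x)" for s
  note meas[OF r, measurable] meas[OF l, measurable]
  have q[measurable]: "q \<in> borel_measurable M" unfolding q_def by measurable
  have [measurable]: "(\<lambda>u. infdist u D) \<in> borel_measurable borel"
    by (intro borel_measurable_continuous_onI continuous_on_infdist continuous_on_id)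
  have a[measurable]: "a \<in> borel_measurable M" unfolding a_def by measurable
  have near': "AE s in M. \<forall>k. norm (resolvent (r k) (A s) x - \<pi> s) \<le> r k * c s"
    unfolding AE_all_countable using near[OF r] by blast
  have lim: "AE s in M. (\<lambda>k. resolvent (r k) (A s) x) \<longlonglongrightarrow> q s \<and> q s = \<pi> s"
    using near'
  proof eventually_elim
    case (elim s)
    have "(\<lambda>k. resolvent (r k) (A s) x - \<pi> s) \<longlonglongrightarrow> 0"
    proof (rule Lim_null_comparison)
      show "\<forall>\<^sub>F k in sequentially. norm (resolvent (r k) (A s) x - \<pi> s) \<le> r k * c s"
        using elim by (intro always_eventually)
      show "(\<lambda>k. r k * c s) \<longlonglongrightarrow> 0" using tendsto_mult[OF r0 tendsto_const[of "c s"]] by simp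
    qed
    then have "(\<lambda>k. resolvent (r k) (A s) x) \<longlonglongrightarrow> \<pi> s" by (simp add: LIM_zero_iff)
    then show ?case unfolding q_def by (simp add: limI)
  qed
  have gap: "ennreal (\<kappa> * d\<^sup>2) \<le> (\<integral>\<^sup>+ s. ennreal ((norm (x - q s))\<^sup>2) \<partial>M)"
  proof -
    have "ennreal (\<kappa> * d\<^sup>2) = ennreal \<kappa> * (set_edist x D)\<^sup>2"
      using ne k(1) unfolding d_def D_def
      by (simp add: set_edist_eq_infdist infdist_nonneg ennreal_mult ennreal_power)
    also have "\<dots> \<le> (\<integral>\<^sup>+ s. (set_edist x (op_dom (A s)))\<^sup>2 \<partial>M)"
      using k(2) by (simp add: D_def)
    also have "\<dots> \<le> (\<integral>\<^sup>+ s. ennreal ((norm (x - q s))\<^sup>2) \<partial>M)"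
    proof (rule nn_integral_mono_AE)
      show "AE s in M. (set_edist x (op_dom (A s)))\<^sup>2 \<le> ennreal ((norm (x - q s))\<^sup>2)"
        using max lim
      proof eventually_elim
        case (elim s)
        have "set_edist x (op_dom (A s)) \<le> ennreal (norm (x - q s))"
          by (rule resolvent_limit_inequalities(1)[OF elim(1) r r0]) (use elim in blast)
        then have "(set_edist x (op_dom (A s)))\<^sup>2 \<le> (ennreal (norm (x - q s)))\<^sup>2"
          by (intro power_mono) auto
        then show ?case by (simp add: ennreal_power)
      qed
    qed
    finally show ?thesis .
  qed
  have bound: "(\<integral>\<^sup>+ s. ennreal (a s) \<partial>M) + ennreal ((1 + \<kappa>) * (\<kappa> * d\<^sup>2))
      \<le> ennreal ((1 + \<kappa>) * (norm (x - y))\<^sup>2 + E)" if y: "y \<in> D" for y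
  proof -
    define g where "g s = (1 + \<kappa>) * (norm (x - y))\<^sup>2 + (1 + 1 / \<kappa>) * (l\<^sup>2 * (c s)\<^sup>2)" for s
    have gint: "integrable M g" unfolding g_def using csq by simp
    have le: "AE s in M. a s + (1 + \<kappa>) * (norm (x - q s))\<^sup>2 \<le> g s"
      using max lim near[OF l] y[unfolded D_def essential_domain_def, simplified]
    proof eventually_elim
      case (elim s)
      let ?j = "resolvent l (A s) x"
      have "infdist ?j D \<le> norm (?j - y)" using infdist_le[OF y, of ?j] by (simp add: dist_norm)
      also have "\<dots> \<le> norm (q s - y) + l * c s"
        using norm_triangle_ineq[of "q s - y" "?j - q s"] elim by simp
      finally have "a s \<le> (norm (q s - y) + l * c s)\<^sup>2"
        unfolding a_def by (intro power_mono infdist_nonneg)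
      also have "\<dots> \<le> (1 + \<kappa>) * (norm (q s - y))\<^sup>2 + (1 + 1 / \<kappa>) * (l * c s)\<^sup>2"
        by (rule power2_sum_le_weighted[OF k(1)])
      finally have "a s \<le> (1 + \<kappa>) * (norm (q s - y))\<^sup>2 + (1 + 1 / \<kappa>) * (l\<^sup>2 * (c s)\<^sup>2)"
        by (simp add: power_mult_distrib)
      moreover have "(norm (q s - y))\<^sup>2 + (norm (x - q s))\<^sup>2 \<le> (norm (x - y))\<^sup>2"
        by (rule resolvent_limit_inequalities(2)[OF elim(1) r r0 _ elim(4)]) (use elim in blast)
      then have "(1 + \<kappa>) * ((norm (q s - y))\<^sup>2 + (norm (x - q s))\<^sup>2) \<le> (1 + \<kappa>) * (norm (x - y))\<^sup>2"
        using k(1) by (intro mult_left_mono) auto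
      ultimately show ?case unfolding g_def by (simp add: distrib_left)
    qed
    have "(\<integral>\<^sup>+ s. ennreal (a s) \<partial>M) + ennreal ((1 + \<kappa>) * (\<kappa> * d\<^sup>2))
       \<le> (\<integral>\<^sup>+ s. ennreal (a s) \<partial>M) + ennreal (1 + \<kappa>) * (\<integral>\<^sup>+ s. ennreal ((norm (x - q s))\<^sup>2) \<partial>M)"
      using gap k(1) by (auto simp: ennreal_mult intro!: add_left_mono mult_left_mono)
    also have "\<dots> = (\<integral>\<^sup>+ s. ennreal (a s) + ennreal (1 + \<kappa>) * ennreal ((norm (x - q s))\<^sup>2) \<partial>M)"
      by (subst nn_integral_add) (auto simp: nn_integral_cmult)
    also have "\<dots> = (\<integral>\<^sup>+ s. ennreal (a s + (1 + \<kappa>) * (norm (x - q s))\<^sup>2) \<partial>M)"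
      using k(1) by (intro nn_integral_cong) (simp add: ennreal_plus ennreal_mult a_def del: ennreal_plus[symmetric])
    also have "\<dots> \<le> (\<integral>\<^sup>+ s. ennreal (g s) \<partial>M)"
      using le by (intro nn_integral_mono_AE) (auto intro: ennreal_leI)
    also have "\<dots> = ennreal (integral\<^sup>L M g)"
      by (rule nn_integral_eq_integral[OF gint]) (use k(1) in \<open>simp add: g_def\<close>)
    also have "integral\<^sup>L M g = (1 + \<kappa>) * (norm (x - y))\<^sup>2 + E"
      unfolding g_def E_def using csq by (simp add: prob_space)
    finally show ?thesis .
  qed
  obtain y0 where y0: "y0 \<in> D" using ne by (auto simp: D_def)
  have "(\<integral>\<^sup>+ s. ennreal (a s) \<partial>M) < \<infinity>"
    using bound[OF y0] by (cases "(\<integral>\<^sup>+ s. ennreal (a s) \<partial>M) = \<top>") (auto simp: less_top top_unique)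
  then obtain i where i: "0 \<le> i" "(\<integral>\<^sup>+ s. ennreal (a s) \<partial>M) = ennreal i"
    by (cases "\<integral>\<^sup>+ s. ennreal (a s) \<partial>M") auto
  have E0: "0 \<le> E" using k(1) by (simp add: E_def)
  have real_bound: "i + (1 + \<kappa>) * (\<kappa> * d\<^sup>2) \<le> (1 + \<kappa>) * t\<^sup>2 + E" if t: "d < t" for t
  proof -
    obtain y where y: "y \<in> D" "dist x y < t"
      using infdist_lessE[OF t[unfolded d_def]] y0 by blast
    have "ennreal (i + (1 + \<kappa>) * (\<kappa> * d\<^sup>2)) \<le> ennreal ((1 + \<kappa>) * (norm (x - y))\<^sup>2 + E)"
      using bound[OF y(1)] i k(1) by (simp add: ennreal_plus)
    then have "i + (1 + \<kappa>) * (\<kappa> * d\<^sup>2) \<le> (1 + \<kappa>) * (norm (x - y))\<^sup>2 + E"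
      using k(1) E0 by (subst (asm) ennreal_le_iff) auto
    also have "(norm (x - y))\<^sup>2 \<le> t\<^sup>2" using y(2) by (intro power_mono) (auto simp: dist_norm)
    finally show ?thesis using k(1) by (simp add: mult_left_mono)
  qed
  have "i + (1 + \<kappa>) * (\<kappa> * d\<^sup>2) \<le> (1 + \<kappa>) * d\<^sup>2 + E"
  proof (rule tendsto_lowerbound[where F="at_right d" and f="\<lambda>t. (1 + \<kappa>) * t\<^sup>2 + E"])
    show "((\<lambda>t. (1 + \<kappa>) * t\<^sup>2 + E) \<longlongrightarrow> (1 + \<kappa>) * d\<^sup>2 + E) (at_right d)"
      by (intro tendsto_intros)
    show "\<forall>\<^sub>F t in at_right d. i + (1 + \<kappa>) * (\<kappa> * d\<^sup>2) \<le> (1 + \<kappa>) * t\<^sup>2 + E"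
      unfolding eventually_at_right_field by (rule exI[of _ "d + 1"]) (use real_bound in auto)
  qed simp
  then have "i \<le> (1 - \<kappa>\<^sup>2) * d\<^sup>2 + E" by (simp add: algebra_simps power2_eq_square)
  then show ?thesis using i unfolding a_def D_def d_def E_def by (simp add: ennreal_leI)
qed

text \<open>
  A step \<open>u - b\<close> with nonpositive mean raises the squared positive part only by its second moment:
  the cross term \<open>2 max 0 Y (u - b)\<close> has nonpositive mean, and \<open>(u - b)\<^sup>2 \<le> u\<^sup>2 + b\<^sup>2\<close> because both
  numbers are nonnegative.
\<close>
lemma (in prob_space) pos_part_mean_square_le:
  fixes u :: "'a \<Rightarrow> real"
  assumes [measurable]: "u \<in> borel_measurable M" and u0: "\<And>s. 0 \<le> u s" and b: "0 \<le> b"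
    and le: "(\<integral>\<^sup>+ s. ennreal ((u s)\<^sup>2) \<partial>M) \<le> ennreal (b\<^sup>2)"
  shows "(\<integral>\<^sup>+ s. ennreal ((max 0 (Y + u s - b))\<^sup>2) \<partial>M) \<le> ennreal ((max 0 Y)\<^sup>2 + 2 * b\<^sup>2)"
proof -
  have sq: "integrable M (\<lambda>s. (u s)\<^sup>2)"
    using le by (intro integrableI_nonneg) (auto simp: less_top[symmetric] top_unique)
  have int: "integrable M u" by (rule square_integrable_imp_integrable[OF _ sq]) simp
  have sqle: "(\<integral> s. (u s)\<^sup>2 \<partial>M) \<le> b\<^sup>2"
    using le sq by (subst (asm) nn_integral_eq_integral) auto
  have "(expectation u)\<^sup>2 \<le> (\<integral> s. (u s)\<^sup>2 \<partial>M)"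
    using variance_positive[of u] variance_eq[OF int sq] by simp
  then have "(expectation u)\<^sup>2 \<le> b\<^sup>2" using sqle by simp
  then have mean: "expectation u \<le> b" using b by (rule power2_le_imp_le)
  define g where "g s = (max 0 Y)\<^sup>2 + 2 * max 0 Y * (u s - b) + ((u s)\<^sup>2 + b\<^sup>2)" for s
  have gint: "integrable M g" unfolding g_def using int sq by simp
  have pt: "(max 0 (Y + u s - b))\<^sup>2 \<le> g s" for s
  proof -
    have "(max 0 (Y + u s - b))\<^sup>2 \<le> (max 0 Y + (u s - b))\<^sup>2"
    proof (cases "Y + u s - b \<le> 0")
      case False
      then have "max 0 (Y + u s - b) \<le> max 0 Y + (u s - b)" by simp
      then show ?thesis by (intro power_mono) auto
    qed simp
    also have "\<dots> = (max 0 Y)\<^sup>2 + 2 * max 0 Y * (u s - b) + ((u s)\<^sup>2 + b\<^sup>2) - 2 * (u s * b)"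
      by (simp add: power2_sum power2_diff)
    finally show ?thesis using u0[of s] b by (simp add: g_def) (smt (verit) mult_nonneg_nonneg)
  qed
  have "(\<integral>\<^sup>+ s. ennreal ((max 0 (Y + u s - b))\<^sup>2) \<partial>M) \<le> (\<integral>\<^sup>+ s. ennreal (g s) \<partial>M)"
    by (intro nn_integral_mono ennreal_leI pt)
  also have "\<dots> = ennreal (integral\<^sup>L M g)"
    using order_trans[OF zero_le_power2 pt] by (intro nn_integral_eq_integral[OF gint]) auto
  also have "integral\<^sup>L M g = (max 0 Y)\<^sup>2 + 2 * max 0 Y * (expectation u - b) + ((\<integral> s. (u s)\<^sup>2 \<partial>M) + b\<^sup>2)"
    unfolding g_def using int sq by (simp add: prob_space)
  also have "ennreal \<dots> \<le> ennreal ((max 0 Y)\<^sup>2 + 2 * b\<^sup>2)"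
    using mean sqle by (intro ennreal_leI) (smt (verit) mult_nonneg_nonpos max.cobounded1)
  finally show ?thesis .
qed

section \<open>Pathwise bounds from one-step drifts\<close>

text \<open>
  Adding the tail of the summable series of errors turns \<open>V\<close> into a supermartingale.
\<close>
lemma (in prob_space) driven_almost_decreasing_bounded:
  fixes V :: "'z \<Rightarrow> real"
  assumes ind: "indep_vars (\<lambda>_. N) \<xi> {1..}"
    and law: "\<And>n. n \<ge> 1 \<Longrightarrow> distr M N (\<xi> n) = N"
    and F: "\<And>n. F n \<in> S \<Otimes>\<^sub>M N \<rightarrow>\<^sub>M S" and z: "z \<in> space S"
    and V[measurable]: "V \<in> borel_measurable S" and V0: "\<And>x. 0 \<le> V x"
    and e: "summable e" "\<And>n. 0 \<le> e n"
    and drift: "\<And>n x. x \<in> space S \<Longrightarrow> (\<integral>\<^sup>+ s. ennreal (V (F n (x, s))) \<partial>N) \<le> ennreal (V x + e n)"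
  shows "AE w in M. \<exists>c::nat. \<forall>n. V (driven F z (\<lambda>i. \<xi> i w) n) \<le> real c"
proof -
  have X: "\<xi> 1 \<in> M \<rightarrow>\<^sub>M N" using ind unfolding indep_vars_def by auto
  interpret N: prob_space N
    using prob_space_distr[OF X] law[of 1] by simp
  define tail where "tail n = suminf e - (\<Sum>k<n. e k)" for n
  have tail0: "0 \<le> tail n" for n
    unfolding tail_def using sum_le_suminf[OF e(1), of "{..<n}"] e(2) by simp
  have tail_Suc: "tail n = e n + tail (Suc n)" for n by (simp add: tail_def)
  define W where "W n x = ennreal (V x + tail n)" for n x
  have "AE w in M. (\<forall>n. driven F z (\<lambda>i. \<xi> i w) n \<in> space S) \<longrightarrow>
      (\<exists>c. \<forall>n. W n (driven F z (\<lambda>i. \<xi> i w) n) < of_nat c)"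
  proof (rule driven_supermartingale_bounded[OF ind law F z])
    show "W n \<in> borel_measurable S" for n unfolding W_def by measurable
    show "(\<integral>\<^sup>+ s. W (Suc n) (F n (x, s)) \<partial>N) \<le> W n x" if x: "x \<in> space S" for n x
    proof -
      have [measurable]: "(\<lambda>s. V (F n (x, s))) \<in> borel_measurable N"
        using measurable_compose[OF measurable_Pair1'[OF x] measurable_compose[OF F V]] .
      have "(\<integral>\<^sup>+ s. W (Suc n) (F n (x, s)) \<partial>N)
          = (\<integral>\<^sup>+ s. ennreal (V (F n (x, s))) + ennreal (tail (Suc n)) \<partial>N)"
        unfolding W_def using V0 tail0 by (simp add: ennreal_plus)
      also have "\<dots> = (\<integral>\<^sup>+ s. ennreal (V (F n (x, s))) \<partial>N) + ennreal (tail (Suc n))"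
        by (subst nn_integral_add) (auto simp: N.emeasure_space_1)
      also have "\<dots> \<le> ennreal (V x + e n) + ennreal (tail (Suc n))"
        by (intro add_right_mono drift x)
      also have "\<dots> = W n x"
        unfolding W_def tail_Suc[of n] using V0[of x] tail0[of "Suc n"] e(2)[of n]
        by (simp add: ennreal_plus[symmetric] add.assoc del: ennreal_plus)
      finally show ?thesis .
    qed
  qed (auto simp: W_def)
  then show ?thesis
    using AE_space
  proof eventually_elim
    case (elim w)
    then have "driven F z (\<lambda>i. \<xi> i w) n \<in> space S" for n
      using measurable_space[OF measurable_driven[where F=F, OF ind F z]] by blast
    with elim obtain c :: nat where c: "W n (driven F z (\<lambda>i. \<xi> i w) n) < of_nat c" for n
      by blast
    have "V (driven F z (\<lambda>i. \<xi> i w) n) \<le> real c" (is "?V \<le> _") for n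
    proof -
      have "ennreal ?V \<le> W n (driven F z (\<lambda>i. \<xi> i w) n)"
        unfolding W_def using tail0[of n] by (intro ennreal_leI) simp
      also have "\<dots> < ennreal (real c)"
        using c[of n] by (simp add: ennreal_of_nat_eq_real_of_nat)
      finally show ?thesis using V0 by (simp add: ennreal_less_iff)
    qed
    then show ?case by blast
  qed
qed

text \<open>
  The increments compare \<open>d\<close> after a step with the bound \<open>b\<close> on its conditional root mean square, so
  their partial sums \<open>Y\<close> have nonpositive drift. By \<open>pos_part_mean_square_le\<close> a step raises the
  mean of \<open>(max 0 Y)\<^sup>2\<close> by at most \<open>2 b\<^sup>2 = 2 \<rho> d\<^sup>2 + 2 e\<close>. The contraction of \<open>d\<^sup>2\<close> pays for it: adding
  \<open>\<alpha> d\<^sup>2\<close> with \<open>(2 + \<alpha>) \<rho> = \<alpha>\<close> leaves an excess of \<open>(2 + \<alpha>) e\<close>, which the tail of a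
  convergent series absorbs.
\<close>
lemma (in prob_space) driven_contraction_increments_bounded:
  fixes d :: "'z \<Rightarrow> real"
  assumes ind: "indep_vars (\<lambda>_. N) \<xi> {1..}"
    and law: "\<And>n. n \<ge> 1 \<Longrightarrow> distr M N (\<xi> n) = N"
    and F: "\<And>n. F n \<in> S \<Otimes>\<^sub>M N \<rightarrow>\<^sub>M S" and z: "z \<in> space S"
    and d[measurable]: "d \<in> borel_measurable S" and d0: "\<And>x. 0 \<le> d x"
    and e: "summable e" "\<And>n. 0 \<le> e n"
    and \<rho>: "0 \<le> \<rho>" "\<rho> < 1"
    and G: "G \<in> sets S"
    and drift: "\<And>n x. x \<in> G \<Longrightarrow>
        (\<integral>\<^sup>+ s. ennreal ((d (F n (x, s)))\<^sup>2) \<partial>N) \<le> ennreal (\<rho> * (d x)\<^sup>2 + e n)"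
  shows "AE w in M. (\<forall>n. driven F z (\<lambda>i. \<xi> i w) n \<in> G) \<longrightarrow>
    (\<exists>c. \<forall>n. (\<Sum>k<n. d (driven F z (\<lambda>i. \<xi> i w) (Suc k))
        - sqrt (\<rho> * (d (driven F z (\<lambda>i. \<xi> i w) k))\<^sup>2 + e k)) \<le> c)"
proof -
  note [measurable] = F G
  have X: "\<xi> 1 \<in> M \<rightarrow>\<^sub>M N" using ind unfolding indep_vars_def by auto
  interpret N: prob_space N
    using prob_space_distr[OF X] law[of 1] by simp
  define b where "b n x = sqrt (\<rho> * (d x)\<^sup>2 + e n)" for n x
  have bsq: "(b n x)\<^sup>2 = \<rho> * (d x)\<^sup>2 + e n" and b0: "0 \<le> b n x" for n x
    unfolding b_def using \<rho>(1) e(2)[of n] by simp_all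
  have [measurable]: "b n \<in> borel_measurable S" for n unfolding b_def by measurable
  define S' where "S' = S \<Otimes>\<^sub>M (borel :: real measure)"
  define F' where "F' n = (\<lambda>((x, Y), s). (F n (x, s), Y + d (F n (x, s)) - b n x))" for n
  define \<alpha> where "\<alpha> = 2 * \<rho> / (1 - \<rho>)"
  have \<alpha>: "0 \<le> \<alpha>" "(2 + \<alpha>) * \<rho> = \<alpha>"
    using \<rho> by (simp_all add: \<alpha>_def field_simps)
  define tail where "tail n = suminf e - (\<Sum>k<n. e k)" for n
  have tail0: "0 \<le> tail n" for n
    unfolding tail_def using sum_le_suminf[OF e(1), of "{..<n}"] e(2) by simp
  have tail_Suc: "tail n = e n + tail (Suc n)" for n by (simp add: tail_def)
  define W where "W n = (\<lambda>(x, Y). ennreal ((max 0 Y)\<^sup>2 + \<alpha> * (d x)\<^sup>2 + (2 + \<alpha>) * tail n))" for n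
  define Z where "Z w n = driven F z (\<lambda>i. \<xi> i w) n" for w n
  define Z' where "Z' w n = driven F' (z, 0) (\<lambda>i. \<xi> i w) n" for w n
  have Z': "Z' w n = (Z w n, \<Sum>k<n. d (Z w (Suc k)) - b k (Z w k))" for w n
    unfolding Z_def Z'_def by (induction n) (auto simp: F'_def)
  have "AE w in M. (\<forall>n. Z' w n \<in> G \<times> UNIV) \<longrightarrow> (\<exists>c. \<forall>n. W n (Z' w n) < of_nat c)"
    unfolding Z'_def
  proof (rule driven_supermartingale_bounded[OF ind law])
    have "(\<lambda>p. (F n (fst (fst p), snd p), snd (fst p) + d (F n (fst (fst p), snd p)) - b n (fst (fst p))))
        \<in> S' \<Otimes>\<^sub>M N \<rightarrow>\<^sub>M S \<Otimes>\<^sub>M borel" for n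
      unfolding S'_def by measurable
    then show "F' n \<in> S' \<Otimes>\<^sub>M N \<rightarrow>\<^sub>M S'" for n
      by (simp add: F'_def S'_def case_prod_beta')
    show "(z, 0) \<in> space S'" using z by (simp add: S'_def space_pair_measure)
    show "W n \<in> borel_measurable S'" for n
      unfolding W_def S'_def by measurable
    show "G \<times> UNIV \<in> sets S'" unfolding S'_def by (intro pair_measureI) auto
    show "(\<integral>\<^sup>+ s. W (Suc n) (F' n (y, s)) \<partial>N) \<le> W n y" if yG: "y \<in> G \<times> UNIV" for n y
    proof -
      obtain x Y where y: "y = (x, Y)" and x: "x \<in> G" using yG by auto
      have xS: "x \<in> space S" using x sets.sets_into_space[OF G] by auto
      have um[measurable]: "(\<lambda>s. d (F n (x, s))) \<in> borel_measurable N"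
        using measurable_compose[OF measurable_Pair1'[OF xS] measurable_compose[OF F d]] .
      have ule: "(\<integral>\<^sup>+ s. ennreal ((d (F n (x, s)))\<^sup>2) \<partial>N) \<le> ennreal ((b n x)\<^sup>2)"
        unfolding bsq by (rule drift[OF x])
      let ?P = "\<integral>\<^sup>+ s. ennreal ((max 0 (Y + d (F n (x, s)) - b n x))\<^sup>2) \<partial>N"
      let ?Q = "\<integral>\<^sup>+ s. ennreal ((d (F n (x, s)))\<^sup>2) \<partial>N"
      have "(\<integral>\<^sup>+ s. W (Suc n) (F' n (y, s)) \<partial>N)
         = (\<integral>\<^sup>+ s. ennreal ((max 0 (Y + d (F n (x, s)) - b n x))\<^sup>2)
             + ennreal \<alpha> * ennreal ((d (F n (x, s)))\<^sup>2) + ennreal ((2 + \<alpha>) * tail (Suc n)) \<partial>N)"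
        unfolding W_def F'_def y using \<alpha>(1) tail0[of "Suc n"]
        by (simp add: ennreal_plus ennreal_mult)
      also have "\<dots> = ?P + ennreal \<alpha> * ?Q + ennreal ((2 + \<alpha>) * tail (Suc n))"
        by (simp add: nn_integral_add nn_integral_cmult N.emeasure_space_1)
      also have "\<dots> \<le> ennreal ((max 0 Y)\<^sup>2 + 2 * (b n x)\<^sup>2) + ennreal \<alpha> * ennreal ((b n x)\<^sup>2)
          + ennreal ((2 + \<alpha>) * tail (Suc n))"
        using N.pos_part_mean_square_le[OF um d0 b0 ule] ule
        by (intro add_mono mult_left_mono) auto
      also have "\<dots> = ennreal ((max 0 Y)\<^sup>2 + 2 * (b n x)\<^sup>2 + \<alpha> * (b n x)\<^sup>2 + (2 + \<alpha>) * tail (Suc n))"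
        using \<alpha>(1) tail0[of "Suc n"] by (simp add: ennreal_plus ennreal_mult)
      also have "(max 0 Y)\<^sup>2 + 2 * (b n x)\<^sup>2 + \<alpha> * (b n x)\<^sup>2 + (2 + \<alpha>) * tail (Suc n)
          = (max 0 Y)\<^sup>2 + (2 + \<alpha>) * \<rho> * (d x)\<^sup>2 + (2 + \<alpha>) * tail n"
        unfolding bsq tail_Suc[of n] by (simp add: algebra_simps)
      also have "ennreal \<dots> = W n y" unfolding \<alpha>(2) W_def y by simp
      finally show ?thesis .
    qed
  qed (auto simp: W_def)
  then show ?thesis
    unfolding Z_def[symmetric]
  proof eventually_elim
    case (elim w)
    show ?case
    proof
      assume "\<forall>n. Z w n \<in> G"
      with elim obtain c :: nat where c: "W n (Z' w n) < of_nat c" for n by (auto simp: Z')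
      have "(\<Sum>k<n. d (Z w (Suc k)) - b k (Z w k)) \<le> real c + 1" (is "?Y \<le> _") for n
      proof -
        have "ennreal ((max 0 ?Y)\<^sup>2) \<le> W n (Z' w n)"
          unfolding W_def Z' using \<alpha>(1) tail0[of n] by (auto intro!: ennreal_leI)
        then have "ennreal ((max 0 ?Y)\<^sup>2) < ennreal (real c)"
          using c[of n] by (simp add: ennreal_of_nat_eq_real_of_nat)
        then have "(max 0 ?Y)\<^sup>2 < real c" by (simp add: ennreal_less_iff)
        also have "real c \<le> (real c + 1)\<^sup>2" by (simp add: power2_eq_square algebra_simps)
        finally have "max 0 ?Y < real c + 1" by (rule power2_less_imp_less) simp
        then show ?thesis by simp
      qed
      then show "\<exists>c. \<forall>n. (\<Sum>k<n. d (Z w (Suc k)) - sqrt (\<rho> * (d (Z w k))\<^sup>2 + e k)) \<le> c"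
        unfolding b_def by blast
    qed
  qed
qed

text \<open>
  The partial sums of \<open>sqrt (\<rho> * (d k)\<^sup>2 + K * (l k)\<^sup>2)\<close> are at most \<open>sqrt \<rho>\<close> times those of \<open>d\<close> plus
  \<open>sqrt K\<close> times those of \<open>l\<close>. With \<open>sqrt \<rho> < 1\<close> the first part is absorbed on the left, and all
  constants, including the terms at index \<open>0\<close>, are at most a multiple of \<open>l 1\<close>, hence of the sum.
\<close>
lemma sum_le_of_contraction:
  fixes d l :: "nat \<Rightarrow> real"
  assumes d0: "\<And>k. 0 \<le> d k" and l0: "\<And>k. 0 < l k" and \<rho>: "0 \<le> \<rho>" "\<rho> < 1" and K: "0 \<le> K"
    and le: "\<And>n. (\<Sum>k<n. d (Suc k) - sqrt (\<rho> * (d k)\<^sup>2 + K * (l k)\<^sup>2)) \<le> c"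
  shows "\<exists>C. \<forall>n\<ge>1. (\<Sum>k=1..n. d k) \<le> C * (\<Sum>k=1..n. l k)"
proof -
  define r where "r = sqrt \<rho>"
  have r: "0 \<le> r" "r < 1" unfolding r_def using \<rho> by simp_all
  define B where "B = \<bar>c\<bar> + r * d 0 + sqrt K * l 0"
  have B: "0 \<le> B" unfolding B_def using r d0[of 0] l0[of 0] K by (intro add_nonneg_nonneg) auto
  have "(\<Sum>k=1..n. d k) \<le> (B / l 1 + sqrt K) / (1 - r) * (\<Sum>k=1..n. l k)" if n: "n \<ge> 1" for n
  proof -
    let ?S = "\<Sum>k=1..n. d k" and ?L = "\<Sum>k=1..n. l k"
    have shift: "(\<Sum>k<n. f (Suc k)) = (\<Sum>k=1..n. f k)" for f :: "nat \<Rightarrow> real"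
      by (simp add: sum.atLeast1_atMost_eq)
    have head: "(\<Sum>k<n. f k) \<le> f 0 + (\<Sum>k=1..n. f k)" if "\<And>k. 0 \<le> f k" for f :: "nat \<Rightarrow> real"
    proof -
      have "(\<Sum>k<n. f k) \<le> (\<Sum>k<Suc n. f k)" using that by simp
      also have "\<dots> = f 0 + (\<Sum>k<n. f (Suc k))" by (rule sum.lessThan_Suc_shift)
      finally show ?thesis unfolding shift .
    qed
    have sqrt_le: "sqrt (\<rho> * (d k)\<^sup>2 + K * (l k)\<^sup>2) \<le> r * d k + sqrt K * l k" for k
    proof -
      have "sqrt (\<rho> * (d k)\<^sup>2 + K * (l k)\<^sup>2) \<le> sqrt (\<rho> * (d k)\<^sup>2) + sqrt (K * (l k)\<^sup>2)"
        using \<rho>(1) K by (intro sqrt_add_le_add_sqrt) auto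
      also have "\<dots> = r * d k + sqrt K * l k"
        using d0[of k] l0[of k] by (simp add: real_sqrt_mult r_def)
      finally show ?thesis .
    qed
    have "?S \<le> c + (\<Sum>k<n. sqrt (\<rho> * (d k)\<^sup>2 + K * (l k)\<^sup>2))"
      using le[of n] shift[of d] by (simp add: sum_subtractf)
    also have "\<dots> \<le> c + (\<Sum>k<n. r * d k + sqrt K * l k)"
      by (intro add_left_mono sum_mono sqrt_le)
    also have "\<dots> = c + (r * (\<Sum>k<n. d k) + sqrt K * (\<Sum>k<n. l k))"
      by (simp add: sum.distrib sum_distrib_left)
    also have "\<dots> \<le> c + (r * (d 0 + ?S) + sqrt K * (l 0 + ?L))"
      using head[of d] head[of l] d0 l0 r K by (intro add_left_mono add_mono mult_left_mono) (auto simp: less_imp_le)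
    also have "\<dots> \<le> B + r * ?S + sqrt K * ?L"
      unfolding B_def by (simp add: algebra_simps)
    finally have 1: "(1 - r) * ?S \<le> B + sqrt K * ?L" by (simp add: algebra_simps)
    have "l 1 \<le> ?L" using n l0 by (intro member_le_sum) (auto simp: less_imp_le)
    then have "B * l 1 \<le> B * ?L" using B by (rule mult_left_mono)
    then have "B \<le> B / l 1 * ?L" using l0[of 1] by (simp add: field_simps)
    with 1 have "(1 - r) * ?S \<le> (B / l 1 + sqrt K) * ?L" by (simp add: distrib_right)
    then show ?thesis using r by (simp add: field_simps)
  qed
  then show ?thesis by blast
qed

section \<open>The average distance to the essential domain\<close>

theorem proposition2:
  fixes \<mu> :: "'e measure"
    and P :: "'w measure"
    and A :: "'e \<Rightarrow> 'h::{real_inner, banach, second_countable_topology} \<Rightarrow> 'h set"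
    and \<xi> :: "nat \<Rightarrow> 'w \<Rightarrow> 'e"
    and lam :: "nat \<Rightarrow> real"
    and x0 :: 'h
    and X :: "nat \<Rightarrow> 'w \<Rightarrow> 'h"
  assumes "prob_space \<mu>" and "complete_measure \<mu>"
    and "prob_space P"
    and "AE s in \<mu>. maximal_monotone_op (A s)"
    and "\<And>l x. l > 0 \<Longrightarrow> (\<lambda>s. resolvent l (A s) x) \<in> borel_measurable \<mu>"
    and "\<And>n. lam n > 0"
    and "(\<Sum>n. ennreal (lam n)) = \<infinity>"
    and "summable (\<lambda>n. (lam n)\<^sup>2)"
    and "prob_space.indep_vars P (\<lambda>_. \<mu>) \<xi> {1..}"
    and "\<And>n. n \<ge> 1 \<Longrightarrow> distr P \<mu> (\<xi> n) = \<mu>"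
    and "\<And>R::real. R > 0 \<Longrightarrow> \<exists>\<kappa>::real. \<kappa> > 0 \<and> (\<forall>x. norm x \<le> R \<longrightarrow>
           (\<integral>\<^sup>+ s. (set_edist x (op_dom (A s)))\<^sup>2 \<partial>\<mu>)
             \<ge> ennreal \<kappa> * (set_edist x (essential_domain \<mu> A))\<^sup>2)"
    and "\<exists>(p::nat) (C :: 'e \<Rightarrow> real). p \<ge> 1 \<and>
           C \<in> borel_measurable \<mu> \<and> (\<forall>s\<in>space \<mu>. 0 \<le> C s) \<and> integrable \<mu> (\<lambda>s. (C s)\<^sup>2) \<and>
           (\<forall>x l. l > 0 \<longrightarrow>
              (AE s in \<mu>. norm (resolvent l (A s) x - projection (closure (op_dom (A s))) x)
                 \<le> l * C s * (1 + norm x ^ p))) \<and>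
           zeros \<mu> A (2 * real p) \<noteq> {}"
    and "(\<lambda>n. lam n / lam (Suc n)) \<longlonglongrightarrow> 1"
    and "\<And>w. w \<in> space P \<Longrightarrow> X 0 w = x0"
    and "\<And>n w. w \<in> space P \<Longrightarrow> X (Suc n) w = resolvent (lam n) (A (\<xi> (Suc n) w)) (X n w)"
  shows "AE w in P. (SUP n\<in>{1..}.
           (\<Sum>k=1..n. set_edist (X k w) (essential_domain \<mu> A)) / ennreal (\<Sum>k=1..n. lam k)) < \<infinity>"
proof -
  interpret mu: prob_space \<mu> by fact
  interpret P: prob_space P by fact
  note max = assms(4) and meas = assms(5) and lam_pos = assms(6) and lam_sq = assms(8)
    and ind = assms(9) and law = assms(10) and geom = assms(11) and X0 = assms(14) and XS = assms(15)
  obtain p :: nat and C :: "'e \<Rightarrow> real" where p: "p \<ge> 1"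
    and C: "C \<in> borel_measurable \<mu>" "\<And>s. s \<in> space \<mu> \<Longrightarrow> 0 \<le> C s" "integrable \<mu> (\<lambda>s. (C s)\<^sup>2)"
    and near: "\<And>x l. l > 0 \<Longrightarrow> AE s in \<mu>.
      norm (resolvent l (A s) x - projection (closure (op_dom (A s))) x) \<le> l * C s * (1 + norm x ^ p)"
    and zer: "zeros \<mu> A (2 * real p) \<noteq> {}"
    using assms(12) by blast
  obtain y \<phi> where phi: "\<phi> \<in> selections \<mu> A (2 * real p) y" "has_bochner_integral \<mu> \<phi> 0"
    using zer unfolding zeros_def by blast
  have phim[measurable]: "\<phi> \<in> borel_measurable \<mu>" and phiA: "AE s in \<mu>. \<phi> s \<in> A s y"
    and phip: "integrable \<mu> (\<lambda>s. norm (\<phi> s) powr (2 * real p))"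
    using phi(1) unfolding selections_def by auto
  have phisq: "integrable \<mu> (\<lambda>s. (norm (\<phi> s))\<^sup>2)"
  proof (rule Bochner_Integration.integrable_bound)
    show "integrable \<mu> (\<lambda>s. 1 + norm (\<phi> s) powr (2 * real p))" using phip by simp
    have "(norm (\<phi> s))\<^sup>2 \<le> 1 + norm (\<phi> s) powr (2 * real p)" for s
    proof (cases "norm (\<phi> s) \<le> 1")
      case True
      then have "(norm (\<phi> s))\<^sup>2 \<le> 1" by (simp add: power_le_one)
      then show ?thesis using powr_ge_zero[of "norm (\<phi> s)" "2 * real p"] by linarith
    next
      case False
      then have "norm (\<phi> s) powr 2 \<le> norm (\<phi> s) powr (2 * real p)"
        using p by (intro powr_mono) auto
      then show ?thesis using False by simp
    qed
    then show "AE s in \<mu>. norm ((norm (\<phi> s))\<^sup>2) \<le> norm (1 + norm (\<phi> s) powr (2 * real p))"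
      by (intro AE_I2) (simp add: abs_of_nonneg)
  qed measurable

  define D where "D = essential_domain \<mu> A"
  have yD: "y \<in> D"
    unfolding D_def essential_domain_def using phiA by (auto simp: op_dom_def elim!: eventually_mono)
  then have Dne: "D \<noteq> {}" by blast

  \<comment> \<open>Off a null set of noise values the resolvent is nonexpansive. Replacing it there by the
    identity gives a jointly measurable map, and almost surely the same iterates.\<close>
  obtain N where N: "{s \<in> space \<mu>. \<not> maximal_monotone_op (A s)} \<subseteq> N" "N \<in> null_sets \<mu>"
    using max by (elim AE_E) (auto intro: that)
  have maxN: "maximal_monotone_op (A s)" if "s \<in> space \<mu>" "s \<notin> N" for s
    using N(1) that by blast
  have notN: "AE s in \<mu>. s \<notin> N" using N(2) by (rule AE_not_in)
  define J where "J n s x = (if s \<in> N then x else resolvent (lam n) (A s) x)" for n s x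
  have Jres: "AE s in \<mu>. \<forall>x. J n s x = resolvent (lam n) (A s) x" for n
    using notN by eventually_elim (simp add: J_def)
  define F where "F n = (\<lambda>(x, s). J n s x)" for n
  have Fm: "F n \<in> borel \<Otimes>\<^sub>M \<mu> \<rightarrow>\<^sub>M borel" for n
  proof -
    have [measurable]: "N \<in> sets \<mu>" using N(2) by auto
    have "(\<lambda>p. J n (fst p) (snd p)) \<in> borel_measurable (\<mu> \<Otimes>\<^sub>M borel)"
    proof (rule borel_measurable_Caratheodory)
      show "(\<lambda>s. J n s x) \<in> borel_measurable \<mu>" for x
        unfolding J_def using meas[OF lam_pos[of n], of x] by measurable
      show "continuous_on UNIV (J n s)" if s: "s \<in> space \<mu>" for s
      proof (rule lipschitz_on_continuous_on)
        show "1-lipschitz_on UNIV (J n s)"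
          unfolding J_def using maxN[OF s] resolvent_nonexpansive[OF _ lam_pos[of n]]
          by (intro lipschitz_onI) (auto simp: dist_norm)
      qed
    qed
    then have "(\<lambda>p. J n (fst (snd p, fst p)) (snd (snd p, fst p))) \<in> borel_measurable (borel \<Otimes>\<^sub>M \<mu>)"
      by (rule measurable_compose[rotated]) measurable
    then show ?thesis by (simp add: F_def case_prod_beta')
  qed
  define Z where "Z w n = driven F x0 (\<lambda>i. \<xi> i w) n" for w n

  have XZ: "AE w in P. \<forall>n. X n w = Z w n"
  proof -
    have "AE w in P. \<xi> (Suc n) w \<notin> N" for n
    proof (rule AE_distrD[where f="\<xi> (Suc n)" and M'=\<mu>])
      show "\<xi> (Suc n) \<in> P \<rightarrow>\<^sub>M \<mu>" using ind unfolding P.indep_vars_def by auto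
      show "AE s in distr P \<mu> (\<xi> (Suc n)). s \<notin> N" by (subst law) (use notN in auto)
    qed
    then have "AE w in P. \<forall>n. \<xi> (Suc n) w \<notin> N" unfolding AE_all_countable by blast
    then show ?thesis
      using AE_space
    proof eventually_elim
      case (elim w)
      have "X n w = Z w n" for n
        unfolding Z_def by (induction n) (use elim in \<open>auto simp: X0 XS F_def J_def\<close>)
      then show ?case by blast
    qed
  qed

  have "AE w in P. \<exists>c::nat. \<forall>n. (norm (Z w n - y))\<^sup>2 \<le> real c"
    unfolding Z_def
  proof (rule P.driven_almost_decreasing_bounded[OF ind law Fm])
    show "summable (\<lambda>n. (lam n)\<^sup>2 * (\<integral> s. (norm (\<phi> s))\<^sup>2 \<partial>\<mu>))"
      using lam_sq by (rule summable_mult2)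
    show "(\<integral>\<^sup>+ s. ennreal ((norm (F n (x, s) - y))\<^sup>2) \<partial>\<mu>)
        \<le> ennreal ((norm (x - y))\<^sup>2 + (lam n)\<^sup>2 * (\<integral> s. (norm (\<phi> s))\<^sup>2 \<partial>\<mu>))" for n x
    proof -
      have "(\<integral>\<^sup>+ s. ennreal ((norm (F n (x, s) - y))\<^sup>2) \<partial>\<mu>)
          = (\<integral>\<^sup>+ s. ennreal ((norm (resolvent (lam n) (A s) x - y))\<^sup>2) \<partial>\<mu>)"
        by (rule nn_integral_cong_AE) (use Jres[of n] in \<open>auto simp: F_def elim!: eventually_mono\<close>)
      then show ?thesis
        using mu.resolvent_mean_square_le[OF max lam_pos phiA phi(2) phisq] by simp
    qed
  qed auto
  then have bounded: "AE w in P. \<exists>R::nat. \<forall>n. norm (Z w n) \<le> real R"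
  proof eventually_elim
    case (elim w)
    then obtain c :: nat where c: "(norm (Z w n - y))\<^sup>2 \<le> real c" for n by blast
    obtain R :: nat where R: "norm y + sqrt (real c) \<le> real R" using real_arch_simple by blast
    have "norm (Z w n) \<le> real R" for n
    proof -
      have "norm (Z w n - y) \<le> sqrt (real c)" using c[of n] by (rule real_le_rsqrt)
      then show ?thesis using norm_triangle_ineq[of y "Z w n - y"] R by simp
    qed
    then show ?case by blast
  qed

  define d where "d x = infdist x D" for x
  have d0: "0 \<le> d x" for x unfolding d_def by (rule infdist_nonneg)
  have dm: "d \<in> borel_measurable borel"
    unfolding d_def by (intro borel_measurable_continuous_onI continuous_on_infdist continuous_on_id)

  have ratio: "AE w in P. (\<forall>n. norm (Z w n) \<le> real R) \<longrightarrow>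
      (\<exists>c. \<forall>n\<ge>1. (\<Sum>k=1..n. d (Z w k)) \<le> c * (\<Sum>k=1..n. lam k))" for R :: nat
  proof -
    obtain \<kappa>0 where \<kappa>0: "\<kappa>0 > 0" and sep0: "\<And>x. norm x \<le> real (Suc R) \<Longrightarrow>
        ennreal \<kappa>0 * (set_edist x D)\<^sup>2 \<le> (\<integral>\<^sup>+ s. (set_edist x (op_dom (A s)))\<^sup>2 \<partial>\<mu>)"
      using geom[of "real (Suc R)"] unfolding D_def by auto
    \<comment> \<open>The cap at \<open>1\<close> makes the contraction factor nonnegative.\<close>
    define \<kappa> where "\<kappa> = min \<kappa>0 1"
    have \<kappa>: "0 < \<kappa>" "\<kappa> \<le> 1" "\<kappa> \<le> \<kappa>0" unfolding \<kappa>_def using \<kappa>0 by auto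
    have sep: "ennreal \<kappa> * (set_edist x D)\<^sup>2 \<le> (\<integral>\<^sup>+ s. (set_edist x (op_dom (A s)))\<^sup>2 \<partial>\<mu>)"
      if "norm x \<le> real R" for x
    proof -
      have "ennreal \<kappa> * (set_edist x D)\<^sup>2 \<le> ennreal \<kappa>0 * (set_edist x D)\<^sup>2"
        using \<kappa>(3) by (intro mult_right_mono ennreal_leI) auto
      also have "\<dots> \<le> (\<integral>\<^sup>+ s. (set_edist x (op_dom (A s)))\<^sup>2 \<partial>\<mu>)"
        by (rule sep0) (use that in simp)
      finally show ?thesis .
    qed
    define \<rho> where "\<rho> = 1 - \<kappa>\<^sup>2"
    have \<rho>: "0 \<le> \<rho>" "\<rho> < 1" unfolding \<rho>_def using \<kappa> by (auto simp: power_le_one)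
    define K where "K = (1 + 1 / \<kappa>) * ((1 + real R ^ p)\<^sup>2 * (\<integral> s. (C s)\<^sup>2 \<partial>\<mu>))"
    have K: "0 \<le> K" unfolding K_def using \<kappa>(1) by simp
    have "AE w in P. (\<forall>n. driven F x0 (\<lambda>i. \<xi> i w) n \<in> {x. norm x \<le> real R}) \<longrightarrow>
      (\<exists>c. \<forall>n. (\<Sum>k<n. d (driven F x0 (\<lambda>i. \<xi> i w) (Suc k))
        - sqrt (\<rho> * (d (driven F x0 (\<lambda>i. \<xi> i w) k))\<^sup>2 + K * (lam k)\<^sup>2)) \<le> c)"
    proof (rule P.driven_contraction_increments_bounded[OF ind law Fm _ dm d0 _ _ \<rho>])
      show "summable (\<lambda>k. K * (lam k)\<^sup>2)" using lam_sq by (rule summable_mult)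
      show "{x::'h. norm x \<le> real R} \<in> sets borel" by measurable
      show "(\<integral>\<^sup>+ s. ennreal ((d (F n (x, s)))\<^sup>2) \<partial>\<mu>) \<le> ennreal (\<rho> * (d x)\<^sup>2 + K * (lam n)\<^sup>2)"
        if "x \<in> {x. norm x \<le> real R}" for n x
      proof -
        have xR: "norm x \<le> real R" using that by simp
        define c where "c s = C s * (1 + norm x ^ p)" for s
        have csq: "integrable \<mu> (\<lambda>s. (c s)\<^sup>2)"
          unfolding c_def power_mult_distrib using C(3) by simp
        have "(\<integral>\<^sup>+ s. ennreal ((d (F n (x, s)))\<^sup>2) \<partial>\<mu>)
          = (\<integral>\<^sup>+ s. ennreal ((infdist (resolvent (lam n) (A s) x) D)\<^sup>2) \<partial>\<mu>)"
          by (rule nn_integral_cong_AE) (use Jres[of n] in \<open>auto simp: F_def d_def elim!: eventually_mono\<close>)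
        also have "\<dots> \<le> ennreal (\<rho> * (d x)\<^sup>2 + (1 + 1 / \<kappa>) * ((lam n)\<^sup>2 * (\<integral> s. (c s)\<^sup>2 \<partial>\<mu>)))"
          unfolding \<rho>_def d_def D_def
        proof (rule mu.resolvent_infdist_mean_square_le[OF max meas _ csq])
          show "AE s in \<mu>. norm (resolvent l (A s) x - projection (closure (op_dom (A s))) x) \<le> l * c s"
            if "l > 0" for l
            using near[OF that, of x] by (simp add: c_def mult.assoc)
        qed (use Dne sep[OF xR] \<kappa>(1) lam_pos in \<open>auto simp: D_def\<close>)
        also have "\<dots> \<le> ennreal (\<rho> * (d x)\<^sup>2 + K * (lam n)\<^sup>2)"
        proof (rule ennreal_leI)
          have "(1 + norm x ^ p)\<^sup>2 \<le> (1 + real R ^ p)\<^sup>2"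
            using xR by (intro power_mono add_left_mono) auto
          then have "(1 + norm x ^ p)\<^sup>2 * (\<integral> s. (C s)\<^sup>2 \<partial>\<mu>) \<le> (1 + real R ^ p)\<^sup>2 * (\<integral> s. (C s)\<^sup>2 \<partial>\<mu>)"
            by (intro mult_right_mono) auto
          moreover have "(\<integral> s. (c s)\<^sup>2 \<partial>\<mu>) = (1 + norm x ^ p)\<^sup>2 * (\<integral> s. (C s)\<^sup>2 \<partial>\<mu>)"
            unfolding c_def power_mult_distrib by (simp add: mult.commute)
          ultimately have "(1 + 1 / \<kappa>) * ((lam n)\<^sup>2 * (\<integral> s. (c s)\<^sup>2 \<partial>\<mu>))
              \<le> (1 + 1 / \<kappa>) * ((lam n)\<^sup>2 * ((1 + real R ^ p)\<^sup>2 * (\<integral> s. (C s)\<^sup>2 \<partial>\<mu>)))"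
            using \<kappa>(1) by (intro mult_left_mono) auto
          also have "\<dots> = K * (lam n)\<^sup>2" by (simp add: K_def mult_ac)
          finally show "\<rho> * (d x)\<^sup>2 + (1 + 1 / \<kappa>) * ((lam n)\<^sup>2 * (\<integral> s. (c s)\<^sup>2 \<partial>\<mu>))
              \<le> \<rho> * (d x)\<^sup>2 + K * (lam n)\<^sup>2" by simp
        qed
        finally show ?thesis .
      qed
    qed (use K in auto)
    then show ?thesis
      unfolding Z_def[symmetric]
    proof eventually_elim
      case (elim w)
      show ?case
      proof
        assume "\<forall>n. norm (Z w n) \<le> real R"
        with elim obtain c where
          "\<And>n. (\<Sum>k<n. d (Z w (Suc k)) - sqrt (\<rho> * (d (Z w k))\<^sup>2 + K * (lam k)\<^sup>2)) \<le> c"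
          by auto
        then show "\<exists>c. \<forall>n\<ge>1. (\<Sum>k=1..n. d (Z w k)) \<le> c * (\<Sum>k=1..n. lam k)"
          by (rule sum_le_of_contraction[OF d0 lam_pos \<rho> K])
      qed
    qed
  qed
  then have "AE w in P. \<forall>R::nat. (\<forall>n. norm (Z w n) \<le> real R) \<longrightarrow>
      (\<exists>c. \<forall>n\<ge>1. (\<Sum>k=1..n. d (Z w k)) \<le> c * (\<Sum>k=1..n. lam k))"
    unfolding AE_all_countable by blast
  then show ?thesis
    using bounded XZ
  proof eventually_elim
    case (elim w)
    then obtain c where c: "(\<Sum>k=1..n. d (Z w k)) \<le> c * (\<Sum>k=1..n. lam k)" if "n \<ge> 1" for n
      by blast
    have "(SUP n\<in>{1..}. (\<Sum>k=1..n. set_edist (X k w) (essential_domain \<mu> A))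
        / ennreal (\<Sum>k=1..n. lam k)) \<le> ennreal c"
    proof (rule SUP_least)
      fix n :: nat assume "n \<in> {1..}"
      then have n: "n \<ge> 1" by simp
      have L: "0 < (\<Sum>k=1..n. lam k)" using n lam_pos by (intro sum_pos) auto
      have "(\<Sum>k=1..n. set_edist (X k w) (essential_domain \<mu> A)) = (\<Sum>k=1..n. ennreal (d (Z w k)))"
        using elim(3) Dne by (simp add: set_edist_eq_infdist d_def D_def)
      also have "\<dots> = ennreal (\<Sum>k=1..n. d (Z w k))" using d0 by (intro sum_ennreal) auto
      finally have "(\<Sum>k=1..n. set_edist (X k w) (essential_domain \<mu> A)) / ennreal (\<Sum>k=1..n. lam k)
          = ennreal ((\<Sum>k=1..n. d (Z w k)) / (\<Sum>k=1..n. lam k))"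
        using L d0 by (simp add: divide_ennreal sum_nonneg)
      also have "\<dots> \<le> ennreal c" using c[OF n] L by (intro ennreal_leI) (simp add: divide_le_eq)
      finally show "(\<Sum>k=1..n. set_edist (X k w) (essential_domain \<mu> A)) / ennreal (\<Sum>k=1..n. lam k)
          \<le> ennreal c" .
    qed
    also have "\<dots> < \<infinity>" by simp
    finally show ?case .
  qed
qed

end
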